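(* Let $C=(C_{ijkl})_{1\le i,j,k,l\le 3}$ be a real fourth order tensor with the symmetries $C_{ijkl}=C_{kjil}=C_{ilkj}$ for all $1\le i,j,k,l\le 3$, and let $$f(\xi)=\sum_{1\le i,j,k,l\le 3}C_{ijkl}\,\xi_{ij}\xi_{kl},\qquad \xi\in\mathbb R^{3\times 3},$$ be the associated quadratic form. Assume that $f\in\mathcal C_3$, i.e. $f$ is quasiconvex, and let $T(y)$ be the $3\times 3$ acoustic tensor ($y$-matrix) of $f$, so that $f(x\otimes y)=x\,T(y)\,x^T$ for all $x,y\in\mathbb R^3$. Assume that $\det(T(y))$ is an extremal polynomial in $y\in\mathbb R^3$. Then: 1. If $\det(T(y))$ is not a perfect square, then $f$ is an extreme ray of $\mathcal C_3$. 2. If $\det(T(y))$ is a perfect square, then $f$ is either an extreme ray of $\mathcal C_3$ or polyconvex.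
   Context: For $x,y\in\mathbb R^3$, $x\otimes y$ is the $3\times 3$ matrix with entries $(x\otimes y)_{ij}=x_iy_j$. Quasiconvexity: a quadratic form $f:\mathbb R^{3\times 3}\to\mathbb R$ is quasiconvex if and only if it is rank-one convex, equivalently $f(x\otimes y)\ge 0$ for all $x,y\in\mathbb R^3$. $\mathcal C_3$ denotes the convex cone of quasiconvex quadratic forms on $\mathbb R^{3\times 3}$. All quadratic forms are taken to be given by tensors with the symmetries $C_{ijkl}=C_{kjil}=C_{ilkj}$; such a form is determined by the biquadratic form $(x,y)\mapsto f(x\otimes y)$, so $\mathcal C_3$ is identified with the convex cone of nonnegative biquadratic forms in $x,y\in\mathbb R^3$. Acoustic tensor ($y$-matrix): $T(y)$ is the symmetric $3\times 3$ matrix with entries $T(y)_{ik}=\sum_{j,l=1}^3C_{ijkl}\,y_jy_l$, which are quadratic forms in $y$. Extreme ray: $f\in\mathcal C_3$ is an extreme ray of $\mathcal C_3$ if one cannot subtract from it a quasiconvex quadratic form other than a multiple of $f$ while preserving quasiconvexity; i.e. whenever $f_1\in\mathcal C_3$ and $f-f_1\in\mathcal C_3$, the form $f_1$ is a scalar multiple of $f$. Polyconvex: $f:\mathbb R^{3\times 3}\to\mathbb R$ is polyconvex if $f(\xi)$ is a convex function of the collection of all minors (of all orders, including first order) of $\xi$. For a quadratic form $f$ this is equivalent to $f$ being the sum of a convex (i.e. positive semidefinite) quadratic form and a linear combination of the $2\times 2$ minors of $\xi$, and equivalent to the biquadratic form $f(x\otimes y)$ being a sum of squares of bilinear forms in $(x,y)$.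 Extremal polynomial: a homogeneous polynomial $P(y)$, $y\in\mathbb R^m$, of degree exactly $2n$ with real coefficients is extremal if $P(y)\ge 0$ for all $y\in\mathbb R^m$ and $P$ cannot be written as the sum of two linearly independent homogeneous polynomials of degree $2n$ that are both nonnegative on $\mathbb R^m$. Here $m=3$ and $2n=6$. Perfect square: a polynomial of the form $p(y)^2$ with $p$ a real polynomial. *)

theory Defs
  imports "HOL-Analysis.Analysis"
begin

definition tensor_symmetric :: "(3 \<Rightarrow> 3 \<Rightarrow> 3 \<Rightarrow> 3 \<Rightarrow> real) \<Rightarrow> bool" where
  "tensor_symmetric C \<longleftrightarrow> (\<forall>i j k l. C i j k l = C k j i l \<and> C i j k l = C i l k j)"

definition quadratic_form :: "(3 \<Rightarrow> 3 \<Rightarrow> 3 \<Rightarrow> 3 \<Rightarrow> real) \<Rightarrow> real^3^3 \<Rightarrow> real" where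
  "quadratic_form C \<xi> = (\<Sum>i\<in>UNIV. \<Sum>j\<in>UNIV. \<Sum>k\<in>UNIV. \<Sum>l\<in>UNIV. C i j k l * \<xi>$i$j * \<xi>$k$l)"

definition outer_product :: "real^3 \<Rightarrow> real^3 \<Rightarrow> real^3^3" (infixl "\<otimes>\<^sub>o" 70) where
  "x \<otimes>\<^sub>o y = (\<chi> i j. x$i * y$j)"

definition acoustic_tensor :: "(3 \<Rightarrow> 3 \<Rightarrow> 3 \<Rightarrow> 3 \<Rightarrow> real) \<Rightarrow> real^3 \<Rightarrow> real^3^3" where
  "acoustic_tensor C y = (\<chi> i k. \<Sum>j\<in>UNIV. \<Sum>l\<in>UNIV. C i j k l * y$j * y$l)"

lemma quadratic_form_outer_product:
  "quadratic_form C (x \<otimes>\<^sub>o y) = x \<bullet> (acoustic_tensor C y *v x)"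
  by (simp add: quadratic_form_def outer_product_def acoustic_tensor_def inner_vec_def
      matrix_vector_mult_def sum_3 algebra_simps)

(* This is meant for quadratic forms only: for those, quasiconvexity is the same as
   rank-one convexity, i.e. nonnegativity on all rank-one matrices. *)
definition quasiconvex_quadratic :: "(real^3^3 \<Rightarrow> real) \<Rightarrow> bool" where
  "quasiconvex_quadratic f \<longleftrightarrow> (\<forall>x y. 0 \<le> f (x \<otimes>\<^sub>o y))"

(* The symmetries of C remove the freedom of adding 2x2 minors, so every element of the
   cone is determined by its values on rank-one matrices. *)
definition quasiconvex_cone :: "(real^3^3 \<Rightarrow> real) set" where
  "quasiconvex_cone =
     {f. (\<exists>C. tensor_symmetric C \<and> f = quadratic_form C) \<and> quasiconvex_quadratic f}"

definition extreme_ray :: "(real^3^3 \<Rightarrow> real) \<Rightarrow> bool" where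
  "extreme_ray f \<longleftrightarrow> f \<in> quasiconvex_cone \<and>
     (\<forall>g. g \<in> quasiconvex_cone \<and> (\<lambda>\<xi>. f \<xi> - g \<xi>) \<in> quasiconvex_cone
          \<longrightarrow> (\<exists>c::real. g = (\<lambda>\<xi>. c * f \<xi>)))"

(* Indices in the type 3 are cyclic, so entry (i,j) is the minor obtained by deleting row i and
   column j, multiplied by its cofactor sign. *)
definition cofactor_matrix :: "real^3^3 \<Rightarrow> real^3^3" where
  "cofactor_matrix \<xi> =
     (\<chi> i j. \<xi>$(i+1)$(j+1) * \<xi>$(i+2)$(j+2) - \<xi>$(i+1)$(j+2) * \<xi>$(i+2)$(j+1))"

definition polyconvex :: "(real^3^3 \<Rightarrow> real) \<Rightarrow> bool" where
  "polyconvex f \<longleftrightarrow> (\<exists>g :: (real^3^3) \<times> (real^3^3) \<times> real \<Rightarrow> real.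
     convex_on UNIV g \<and> (\<forall>\<xi>. f \<xi> = g (\<xi>, cofactor_matrix \<xi>, det \<xi>)))"

(* Real polynomials are identified with the functions they define; the zero polynomial is
   homogeneous of every degree. *)
definition homogeneous_polynomial :: "nat \<Rightarrow> (real^'m \<Rightarrow> real) \<Rightarrow> bool" where
  "homogeneous_polynomial d P \<longleftrightarrow> (\<exists>c :: ('m \<Rightarrow> nat) \<Rightarrow> real. \<forall>y.
     P y = (\<Sum>\<alpha> | (\<Sum>i\<in>UNIV. \<alpha> i) = d. c \<alpha> * (\<Prod>i\<in>UNIV. y$i ^ \<alpha> i)))"

lemma finite_multi_indices: "finite {\<alpha> :: 'm::finite \<Rightarrow> nat. (\<Sum>i\<in>UNIV. \<alpha> i) = d}"
proof (rule finite_subset)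
  show "{\<alpha> :: 'm \<Rightarrow> nat. (\<Sum>i\<in>UNIV. \<alpha> i) = d} \<subseteq> (UNIV :: 'm set) \<rightarrow>\<^sub>E {..d}"
    by (auto intro: member_le_sum)
qed (auto intro: finite_PiE)

(* The exact degree 2n is expressed by P not being the zero polynomial. *)
definition extremal_polynomial :: "nat \<Rightarrow> (real^'m \<Rightarrow> real) \<Rightarrow> bool" where
  "extremal_polynomial n P \<longleftrightarrow>
     homogeneous_polynomial (2 * n) P \<and> (\<exists>y. P y \<noteq> 0) \<and> (\<forall>y. 0 \<le> P y) \<and>
     \<not> (\<exists>P1 P2. homogeneous_polynomial (2 * n) P1 \<and> homogeneous_polynomial (2 * n) P2 \<and>
          (\<forall>y. 0 \<le> P1 y) \<and> (\<forall>y. 0 \<le> P2 y) \<and>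
          (\<forall>a b :: real. (\<forall>y. a * P1 y + b * P2 y = 0) \<longrightarrow> a = 0 \<and> b = 0) \<and>
          (\<forall>y. P y = P1 y + P2 y))"

definition perfect_square :: "(real^'m \<Rightarrow> real) \<Rightarrow> bool" where
  "perfect_square P \<longleftrightarrow> (\<exists>p. real_polynomial_function p \<and> (\<forall>y. P y = (p y)\<^sup>2))"

end

theory Submission
  imports Defs
begin

text \<open>
  Suppose \<open>f\<close> is not an extreme ray, so that \<open>T = A + B\<close> with \<open>A\<close>, \<open>B\<close> positive semidefinite acoustic
  tensors and \<open>A\<close> not a multiple of \<open>T\<close>. All coefficients of \<open>det (s A + t B)\<close> are nonnegative
  sextics with sum \<open>det T\<close>, hence constant multiples of \<open>det T\<close> by extremality: the eigenvalues of
  \<open>A\<close> relative to \<open>T\<close> do not depend on \<open>y\<close>. Subtracting the largest admissible multiple of \<open>T\<close>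
  from \<open>A\<close>, and then the largest admissible multiple of the result \<open>S\<close> from \<open>T\<close>, writes
  \<open>T = R + d S\<close> with \<open>R\<close>, \<open>S\<close> positive semidefinite and \<open>det R = det S = 0\<close> identically.

  A nonnegative biquadratic form with identically vanishing determinant is a sum of squares of
  bilinear forms. If it has rank at most one in \<open>x\<close> for some \<open>y \<noteq> 0\<close>, or in \<open>y\<close> for some \<open>x \<noteq> 0\<close>,
  a Schur complement splits off a square and reduces the number of variables. Otherwise, expanding
  at a zero brings it to a normal form in which singularity forces it to be a quadratic form in
  the cross product of \<open>x\<close> and \<open>y\<close> (in suitable coordinates).

  Hence \<open>f\<close> is a sum of squares and so polyconvex, and by the Cauchy-Binet formula \<open>det T\<close> is a sum
  of squares of cubics; by extremality \<open>det T\<close> is a multiple of one of them.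
\<close>

section \<open>Biquadratic forms in polarised form\<close>

text \<open>The biquadratic form itself is the diagonal \<open>B x x y y\<close>. Carrying the full
  polarisation turns every expansion at a perturbed argument into linearity; the two symmetries pass
  linearity on to the second and fourth arguments.\<close>

definition biform :: "('a::real_vector \<Rightarrow> 'a \<Rightarrow> 'b::real_vector \<Rightarrow> 'b \<Rightarrow> real) \<Rightarrow> bool" where
  "biform B \<longleftrightarrow> (\<forall>x' y y'. linear (\<lambda>x. B x x' y y')) \<and> (\<forall>x x' y'. linear (\<lambda>y. B x x' y y')) \<and>
     (\<forall>x x' y y'. B x x' y y' = B x' x y y') \<and> (\<forall>x x' y y'. B x x' y y' = B x x' y' y)"

definition psd :: "('a \<Rightarrow> 'a \<Rightarrow> 'b \<Rightarrow> 'b \<Rightarrow> real) \<Rightarrow> bool" where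
  "psd B \<longleftrightarrow> (\<forall>x y. 0 \<le> B x x y y)"

definition sos :: "('a::real_vector \<Rightarrow> 'a \<Rightarrow> 'b::real_vector \<Rightarrow> 'b \<Rightarrow> real) \<Rightarrow> bool" where
  "sos B \<longleftrightarrow> (\<exists>gs. (\<forall>g\<in>set gs. bilinear g) \<and> (\<forall>x y. B x x y y = (\<Sum>g\<leftarrow>gs. (g x y)\<^sup>2)))"

text \<open>Exchanges the two variables, so that each fact about \<open>x\<close> yields its mirror
  image for \<open>y\<close>.\<close>

definition swap_form :: "('a \<Rightarrow> 'a \<Rightarrow> 'b \<Rightarrow> 'b \<Rightarrow> real) \<Rightarrow> 'b \<Rightarrow> 'b \<Rightarrow> 'a \<Rightarrow> 'a \<Rightarrow> real" where
  "swap_form B y y' x x' = B x x' y y'"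

text \<open>The polarisation of the square of \<open>g\<close>. The product
  \<open>g x y * g x' y'\<close> alone is not symmetric within each pair of arguments, hence the
  average.\<close>

definition square_form :: "('a \<Rightarrow> 'b \<Rightarrow> real) \<Rightarrow> 'a \<Rightarrow> 'a \<Rightarrow> 'b \<Rightarrow> 'b \<Rightarrow> real" where
  "square_form g x x' y y' = (g x y * g x' y' + g x y' * g x' y) / 2"

lemma biform_sym:
  assumes "biform B"
  shows "B x x' y y' = B x' x y y'" "B x x' y y' = B x x' y' y"
  using assms unfolding biform_def by blast+

lemma biform_linear:
  assumes "biform B"
  shows "linear (\<lambda>x. B x x' y y')" "linear (\<lambda>x'. B x x' y y')"
    "linear (\<lambda>y. B x x' y y')" "linear (\<lambda>y'. B x x' y y')"
proof -
  show "linear (\<lambda>x. B x x' y y')" "linear (\<lambda>y. B x x' y y')"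
    using assms unfolding biform_def by blast+
  have "(\<lambda>x'. B x x' y y') = (\<lambda>x'. B x' x y y')" "(\<lambda>y'. B x x' y y') = (\<lambda>y'. B x x' y' y)"
    using biform_sym[OF assms] by blast+
  then show "linear (\<lambda>x'. B x x' y y')" "linear (\<lambda>y'. B x x' y y')"
    using assms unfolding biform_def by presburger+
qed

lemma biform_simps:
  assumes "biform B"
  shows "B (u + v) x' y y' = B u x' y y' + B v x' y y'"
    "B x (u + v) y y' = B x u y y' + B x v y y'"
    "B x x' (p + q) y' = B x x' p y' + B x x' q y'"
    "B x x' y (p + q) = B x x' y p + B x x' y q"
    "B (u - v) x' y y' = B u x' y y' - B v x' y y'"
    "B x (u - v) y y' = B x u y y' - B x v y y'"
    "B x x' (p - q) y' = B x x' p y' - B x x' q y'"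
    "B x x' y (p - q) = B x x' y p - B x x' y q"
    "B (c *\<^sub>R u) x' y y' = c * B u x' y y'"
    "B x (c *\<^sub>R u) y y' = c * B x u y y'"
    "B x x' (c *\<^sub>R p) y' = c * B x x' p y'"
    "B x x' y (c *\<^sub>R p) = c * B x x' y p"
  using linear_add[OF biform_linear(1)[OF assms]] linear_add[OF biform_linear(2)[OF assms]]
    linear_add[OF biform_linear(3)[OF assms]] linear_add[OF biform_linear(4)[OF assms]]
    linear_diff[OF biform_linear(1)[OF assms]] linear_diff[OF biform_linear(2)[OF assms]]
    linear_diff[OF biform_linear(3)[OF assms]] linear_diff[OF biform_linear(4)[OF assms]]
    linear_scale[OF biform_linear(1)[OF assms]] linear_scale[OF biform_linear(2)[OF assms]]
    linear_scale[OF biform_linear(3)[OF assms]] linear_scale[OF biform_linear(4)[OF assms]]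
  by simp_all

lemma biform_zero:
  assumes "biform B"
  shows "B 0 x' y y' = 0" "B x 0 y y' = 0" "B x x' 0 y' = 0" "B x x' y 0 = 0"
  using linear_0[OF biform_linear(1)[OF assms]] linear_0[OF biform_linear(2)[OF assms]]
    linear_0[OF biform_linear(3)[OF assms]] linear_0[OF biform_linear(4)[OF assms]] by simp_all

lemma biform_swap: "biform B \<Longrightarrow> biform (swap_form B)"
  unfolding biform_def swap_form_def by blast

lemma psd_swap: "psd B \<Longrightarrow> psd (swap_form B)"
  unfolding psd_def swap_form_def by blast

lemma swap_swap [simp]: "swap_form (swap_form B) = B"
  by (intro ext) (simp add: swap_form_def)

lemma bilinear_flip: "bilinear g \<Longrightarrow> bilinear (\<lambda>y x. g x y)"
  unfolding bilinear_def by blast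

lemma sos_swap:
  assumes "sos B"
  shows "sos (swap_form B)"
proof -
  obtain gs where gs: "\<forall>g\<in>set gs. bilinear g" "\<And>x y. B x x y y = (\<Sum>g\<leftarrow>gs. (g x y)\<^sup>2)"
    using assms unfolding sos_def by blast
  have "\<forall>g\<in>set (map (\<lambda>g y x. g x y) gs). bilinear g"
    using gs(1) bilinear_flip by auto
  moreover have "swap_form B y y x x = (\<Sum>g\<leftarrow>map (\<lambda>g y x. g x y) gs. (g y x)\<^sup>2)" for x y
    by (simp add: swap_form_def gs(2) comp_def)
  ultimately show ?thesis unfolding sos_def by blast
qed

lemma biform_add_scale:
  assumes "biform B" "biform B'"
  shows "biform (\<lambda>x x' y y'. c * B x x' y y' + d * B' x x' y y')"
proof -
  have "linear (\<lambda>x. c * B x x' y y' + d * B' x x' y y')" "linear (\<lambda>y. c * B x x' y y' + d * B' x x' y y')" for x x' y y'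
    by (simp_all add: linear_iff biform_simps[OF assms(1)] biform_simps[OF assms(2)] algebra_simps)
  then show ?thesis
    using biform_sym[OF assms(1)] biform_sym[OF assms(2)] unfolding biform_def by metis
qed

lemma biform_square:
  assumes "bilinear g"
  shows "biform (square_form g)"
  using assms unfolding biform_def square_form_def bilinear_def linear_iff
  by (simp add: algebra_simps add_divide_distrib)

lemma square_form_diag [simp]: "square_form g x x y y = (g x y)\<^sup>2"
  by (simp add: square_form_def power2_eq_square)

lemma biform_diff_square:
  assumes "biform B" "bilinear g"
  shows "biform (\<lambda>x x' y y'. B x x' y y' - c * square_form g x x' y y')"
  using biform_add_scale[OF assms(1) biform_square[OF assms(2)], of 1 "-c"] by simp

lemma bilinear_scale_left: "bilinear g \<Longrightarrow> bilinear (\<lambda>x y. (c::real) * (g x y :: real))"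
  unfolding bilinear_def linear_iff by (simp add: algebra_simps)

lemma sos_add_square:
  assumes "sos B'" "bilinear g" "\<And>x y. B x x y y = B' x x y y + (g x y)\<^sup>2"
  shows "sos B"
proof -
  obtain gs where "\<forall>g\<in>set gs. bilinear g" "\<And>x y. B' x x y y = (\<Sum>g\<leftarrow>gs. (g x y)\<^sup>2)"
    using assms(1) unfolding sos_def by blast
  then have "(\<forall>g\<in>set (g # gs). bilinear g) \<and> (\<forall>x y. B x x y y = (\<Sum>g\<leftarrow>g # gs. (g x y)\<^sup>2))"
    using assms by simp
  then show ?thesis unfolding sos_def by blast
qed

lemma sos_combine:
  assumes "sos B" "sos B'" "c \<ge> 0" "\<And>x y. A x x y y = B x x y y + c * B' x x y y"
  shows "sos A"
proof -
  obtain gs where gs: "\<forall>g\<in>set gs. bilinear g" "\<And>x y. B x x y y = (\<Sum>g\<leftarrow>gs. (g x y)\<^sup>2)"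
    using assms(1) unfolding sos_def by blast
  obtain hs where hs: "\<forall>g\<in>set hs. bilinear g" "\<And>x y. B' x x y y = (\<Sum>g\<leftarrow>hs. (g x y)\<^sup>2)"
    using assms(2) unfolding sos_def by blast
  let ?ks = "gs @ map (\<lambda>g x y. sqrt c * g x y) hs"
  have "\<forall>g\<in>set ?ks. bilinear g"
    using gs(1) hs(1) bilinear_scale_left by auto
  moreover have "A x x y y = (\<Sum>g\<leftarrow>?ks. (g x y)\<^sup>2)" for x y
    using assms(3)
    by (simp add: assms(4) gs(2) hs(2) comp_def power_mult_distrib sum_list_const_mult)
  ultimately show ?thesis unfolding sos_def by blast
qed

section \<open>Kernels and Schur complements of nonnegative forms\<close>

lemma quadratic_nonneg_linear_zero:
  fixes b c :: real
  assumes "\<And>t. 0 \<le> b * t + c * t\<^sup>2"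
  shows "b = 0"
proof (rule ccontr)
  assume "b \<noteq> 0"
  \<comment> \<open>\<open>k\<close> exceeds both 0 and \<open>c\<close>, so at
    \<open>t = -b / k\<close> the linear term outweighs the quadratic one.\<close>
  define k where "k = \<bar>c\<bar> + 1"
  have k: "k > 0" "c \<le> k - 1" unfolding k_def by auto
  have "b * (-b / k) + c * (-b/k)\<^sup>2 = (b\<^sup>2 / k\<^sup>2) * (c - k)"
    using k by (simp add: field_simps power2_eq_square)
  also have "\<dots> < 0"
    using k \<open>b \<noteq> 0\<close> by (intro mult_pos_neg) auto
  finally show False using assms[of "-b/k"] by linarith
qed

text \<open>For fixed \<open>y\<close>, a zero of a nonnegative quadratic form is a minimum, so the
  first-order term vanishes in every direction \<open>x'\<close>.\<close>

lemma psd_kernel_left: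
  assumes B: "biform B" "psd B" "B x x y y = 0"
  shows "B x x' y y = 0"
proof -
  have "0 \<le> (2 * B x x' y y) * t + B x' x' y y * t\<^sup>2" for t
  proof -
    have "0 \<le> B (x + t *\<^sub>R x') (x + t *\<^sub>R x') y y"
      using B(2) unfolding psd_def by blast
    also have "\<dots> = (2 * B x x' y y) * t + B x' x' y y * t\<^sup>2"
      using B(3) biform_sym(1)[OF B(1), of x' x y y]
      by (simp add: biform_simps[OF B(1)] power2_eq_square algebra_simps)
    finally show ?thesis .
  qed
  from quadratic_nonneg_linear_zero[OF this] show ?thesis by simp
qed

lemma psd_kernel_right:
  assumes "biform B" "psd B" "B x x y y = 0"
  shows "B x x y y' = 0"
  using psd_kernel_left[OF biform_swap[OF assms(1)] psd_swap[OF assms(2)], of y x y'] assms(3)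
  by (simp add: swap_form_def)

lemma psd_Cauchy_Schwarz_left:
  assumes B: "biform B" "psd B"
  shows "(B x x' y y)\<^sup>2 \<le> B x x y y * B x' x' y y"
proof (cases "B x x y y = 0")
  case True
  then show ?thesis using psd_kernel_left[OF B] by simp
next
  case False
  then have pos: "B x x y y > 0" using B(2) unfolding psd_def by (metis order_le_less)
  \<comment> \<open>A multiple of the component of \<open>x'\<close> orthogonal to \<open>x\<close>
    with respect to the form at \<open>y\<close>.\<close>
  let ?z = "B x x y y *\<^sub>R x' - B x x' y y *\<^sub>R x"
  have "0 \<le> B ?z ?z y y" using B(2) unfolding psd_def by blast
  also have "\<dots> = B x x y y * (B x x y y * B x' x' y y - (B x x' y y)\<^sup>2)"
    using biform_sym(1)[OF B(1), of x' x y y]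
    by (simp add: biform_simps[OF B(1)] power2_eq_square algebra_simps)
  finally show ?thesis using pos by (simp add: zero_le_mult_iff)
qed

text \<open>Where \<open>l\<close> vanishes, \<open>x0\<close> lies in the kernel of the form in
  \<open>x\<close>; hence \<open>B x0 x y y\<close> is divisible by \<open>l\<close> and equals
  \<open>l y * g x y\<close> with \<open>g\<close> bilinear. Subtracting the square of
  \<open>g\<close> removes \<open>x0\<close> from the form. The rest is nonnegative by
  Cauchy-Schwarz off the kernel of \<open>l\<close> and by a limit on it.\<close>

lemma schur_complement:
  assumes B: "biform B" "psd B" and l: "linear l" "\<And>y. B x0 x0 y y = (l y)\<^sup>2"
  obtains B' g where "biform B'" "psd B'" "bilinear g" "\<And>y. B' x0 x0 y y = 0"
    "\<And>x y. B x x y y = B' x x y y + (g x y)\<^sup>2"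
proof (cases "\<forall>y. l y = 0")
  case True
  have "bilinear (\<lambda>x y. 0::real)" by (simp add: bilinear_def linear_iff)
  then show ?thesis using that[OF B, of "\<lambda>x y. 0"] l(2) True by simp
next
  case False
  then obtain y2 where "l y2 \<noteq> 0" by blast
  define y1 where "y1 = (1 / l y2) *\<^sub>R y2"
  have ly1: "l y1 = 1" using \<open>l y2 \<noteq> 0\<close> unfolding y1_def by (simp add: linear_scale[OF l(1)])
  have ker: "B x0 x y y = 0" if "l y = 0" for x y
    using psd_kernel_left[OF B, of x0 y x] l(2) that by simp
  \<comment> \<open>Obtained by solving \<open>B x0 x k k = 0\<close> for \<open>B x0 x y y\<close>,
    where \<open>k\<close> is \<open>y\<close> minus \<open>l y\<close> times \<open>y1\<close> and
    lies in the kernel of \<open>l\<close>.\<close>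
  define g where "g = (\<lambda>x y. 2 * B x0 x y1 y - l y * B x0 x y1 y1)"
  have g: "bilinear g"
    unfolding g_def bilinear_def linear_iff
    by (simp add: biform_simps[OF B(1)] linear_add[OF l(1)] linear_scale[OF l(1)] algebra_simps)
  have fact: "B x0 x y y = l y * g x y" for x y
  proof -
    let ?k = "y - l y *\<^sub>R y1"
    have "l ?k = 0" using ly1 by (simp add: linear_diff[OF l(1)] linear_scale[OF l(1)])
    from ker[OF this, of x] show ?thesis
      using biform_sym(2)[OF B(1), of x0 x y y1]
      by (simp add: biform_simps[OF B(1)] g_def algebra_simps)
  qed
  define B' where "B' = (\<lambda>x x' y y'. B x x' y y' - 1 * square_form g x x' y y')"
  have B'd: "B' x x y y = B x x y y - (g x y)\<^sup>2" for x y unfolding B'_def by simp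
  have nn: "0 \<le> B' x x y y" if "l y \<noteq> 0" for x y
  proof -
    have "(l y * g x y)\<^sup>2 \<le> (l y)\<^sup>2 * B x x y y"
      using psd_Cauchy_Schwarz_left[OF B, of x0 x y] fact l(2) by simp
    then show ?thesis using that unfolding B'd by (simp add: power_mult_distrib)
  qed
  have bB': "biform B'" unfolding B'_def by (rule biform_diff_square[OF B(1) g])
  have "0 \<le> B' x x y y" for x y
  proof (cases "l y = 0")
    case True
    \<comment> \<open>Since \<open>l y = 0\<close> and \<open>l y1 = 1\<close>, the value of
      \<open>l\<close> on this line is \<open>t\<close>, so \<open>y\<close> is approached through
      points where nonnegativity is already known.\<close>
    have "((\<lambda>t. B' x x (y + t *\<^sub>R y1) (y + t *\<^sub>R y1)) \<longlongrightarrow>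
        B' x x y y + 0 * (2 * B' x x y y1) + 0\<^sup>2 * B' x x y1 y1) (at_right 0)"
      unfolding biform_simps[OF bB'] biform_sym(2)[OF bB', of x x y1 y]
      by (rule tendsto_eq_intros refl | simp add: power2_eq_square)+
    moreover have "\<forall>\<^sub>F t in at_right 0. 0 \<le> B' x x (y + t *\<^sub>R y1) (y + t *\<^sub>R y1)"
      using True ly1
      by (auto simp: eventually_at_filter linear_add[OF l(1)] linear_scale[OF l(1)] intro!: always_eventually nn)
    ultimately have "0 \<le> B' x x y y + 0 * (2 * B' x x y y1) + 0\<^sup>2 * B' x x y1 y1"
      by (rule tendsto_lowerbound) simp
    then show ?thesis by simp
  qed (rule nn)
  then have "psd B'" unfolding psd_def by blast
  moreover have "B' x0 x0 y y = 0" for y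
  proof (cases "l y = 0")
    case True
    then have "B x0 x0 y y = 0" by (simp add: l(2))
    moreover have "0 \<le> B' x0 x0 y y" by fact
    ultimately show ?thesis using B'd[of x0 y] by (smt (verit) zero_le_power2)
  next
    case False
    then have "g x0 y = l y" using fact[of x0 y] l(2)[of y] by (simp add: power2_eq_square)
    then show ?thesis by (simp add: B'd l(2))
  qed
  moreover have "B x x y y = B' x x y y + (g x y)\<^sup>2" for x y by (simp add: B'd)
  ultimately show ?thesis by (intro that[OF bB' _ g])
qed

section \<open>Splitting off squares\<close>

text \<open>The constant is the infimum of \<open>g z / f z\<close> over \<open>f z > 0\<close>. The
  third conclusion expresses maximality without claiming that the infimum is attained.\<close>

lemma greatest_multiple_below:
  fixes f g :: "'z \<Rightarrow> real"
  assumes f: "\<And>z. 0 \<le> f z" and g: "\<And>z. 0 \<le> g z" and w: "f w \<noteq> 0"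
  obtains c where "0 \<le> c" "\<And>z. c * f z \<le> g z" "\<And>e. e > 0 \<Longrightarrow> \<exists>z. g z < (c + e) * f z"
proof -
  define R where "R = (\<lambda>z. g z / f z) ` {z. f z > 0}"
  have ne: "R \<noteq> {}" using w f[of w] unfolding R_def by (auto simp: order_le_less)
  have R0: "0 \<le> r" if "r \<in> R" for r using that f g unfolding R_def by auto
  then have bdd: "bdd_below R" by (meson bdd_belowI)
  have "0 \<le> Inf R" using ne R0 by (intro cInf_greatest)
  moreover have "Inf R * f z \<le> g z" for z
  proof (cases "f z = 0")
    case False
    then have "f z > 0" using f[of z] by simp
    then have "Inf R \<le> g z / f z" unfolding R_def
      by (intro cInf_lower) (use bdd R_def in auto)
    then show ?thesis using \<open>f z > 0\<close> by (simp add: field_simps)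
  qed (simp add: g)
  moreover have "\<exists>z. g z < (Inf R + e) * f z" if e: "e > 0" for e
  proof -
    obtain r where "r \<in> R" "r < Inf R + e" using cInf_lessD[OF ne, of "Inf R + e"] e by auto
    then show ?thesis unfolding R_def by (auto simp: field_simps)
  qed
  ultimately show ?thesis using that by blast
qed

lemma biform_expand_left:
  fixes B :: "real^'m \<Rightarrow> real^'m \<Rightarrow> 'b::real_vector \<Rightarrow> 'b \<Rightarrow> real"
  assumes "biform B"
  shows "B x x' y y' = (\<Sum>i\<in>UNIV. x$i * B (axis i 1) x' y y')"
proof -
  have ex: "(\<Sum>i\<in>UNIV. x$i *\<^sub>R axis i 1) = x"
    using basis_expansion[of x] by (simp add: scalar_mult_eq_scaleR)
  show ?thesis
    using linear_sum[OF biform_linear(1)[OF assms], of "\<lambda>i. x$i *\<^sub>R axis i 1" UNIV x' y y']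
    by (simp add: ex biform_simps[OF assms])
qed

text \<open>The coordinate expression makes joint continuity of the diagonal evident.\<close>

lemma biform_expand:
  fixes B :: "real^'m \<Rightarrow> real^'m \<Rightarrow> real^'n \<Rightarrow> real^'n \<Rightarrow> real"
  assumes "biform B"
  shows "B x x' y y' = (\<Sum>i\<in>UNIV. \<Sum>j\<in>UNIV. \<Sum>k\<in>UNIV. \<Sum>l\<in>UNIV.
    B (axis i 1) (axis k 1) (axis j 1) (axis l 1) * x$i * y$j * x'$k * y'$l)"
proof -
  note 1 = biform_expand_left[OF assms] and 3 = biform_expand_left[OF biform_swap[OF assms], unfolded swap_form_def]
  have 2: "B x x' y y' = (\<Sum>i\<in>UNIV. x'$i * B x (axis i 1) y y')" for x x' y y'
    using 1[of x' x y y'] biform_sym(1)[OF assms, of _ x y y'] by simp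
  have 4: "B x x' y y' = (\<Sum>i\<in>UNIV. y'$i * B x x' y (axis i 1))" for x x' y y'
    using 3[of x x' y' y] biform_sym(2)[OF assms, of x x' _ y] by simp
  have "B x x' y y' = (\<Sum>i\<in>UNIV. x$i * (\<Sum>j\<in>UNIV. y$j * (\<Sum>k\<in>UNIV. x'$k * (\<Sum>l\<in>UNIV. y'$l *
      B (axis i 1) (axis k 1) (axis j 1) (axis l 1)))))"
    by (subst 1, subst 3, subst 2, subst 4, rule refl)
  then show ?thesis by (simp add: sum_distrib_left mult_ac)
qed

lemma continuous_on_biform:
  fixes B :: "real^'m \<Rightarrow> real^'m \<Rightarrow> real^'n \<Rightarrow> real^'n \<Rightarrow> real"
  assumes "biform B"
  shows "continuous_on S (\<lambda>p. B (fst p) (fst p) (snd p) (snd p))"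
proof -
  have "continuous_on S (\<lambda>p. \<Sum>i\<in>UNIV. \<Sum>j\<in>UNIV. \<Sum>k\<in>UNIV. \<Sum>l\<in>UNIV.
    B (axis i 1) (axis k 1) (axis j 1) (axis l 1) * fst p$i * snd p$j * fst p$k * snd p$l)"
    by (intro continuous_intros)
  then show ?thesis
    by (rule continuous_on_eq) (rule biform_expand[OF assms, symmetric])
qed

section \<open>Kernels in one variable and the creation of zeros\<close>

definition ker_left :: "('a \<Rightarrow> 'a \<Rightarrow> 'b \<Rightarrow> 'b \<Rightarrow> real) \<Rightarrow> 'a set" where
  "ker_left B = {x. \<forall>y. B x x y y = 0}"

text \<open>Nonnegativity makes the set of common zeros coincide with the radical; this is why
  \<open>ker_left\<close> is a subspace.\<close>

lemma ker_left_iff: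
  assumes "biform B" "psd B"
  shows "x \<in> ker_left B \<longleftrightarrow> (\<forall>x' y. B x x' y y = 0)"
  using psd_kernel_left[OF assms] unfolding ker_left_def by blast

lemma subspace_ker_left:
  assumes "biform B" "psd B"
  shows "subspace (ker_left B)"
  unfolding subspace_def
  by (auto simp: ker_left_iff[OF assms] biform_simps[OF assms(1)] biform_zero[OF assms(1)])

lemma ker_left_shift:
  assumes "biform B" "psd B" "x \<in> ker_left B"
  shows "B (x + z) (x + z) y y = B z z y y"
  using assms(3) biform_sym(1)[OF assms(1), of z x y y]
  by (simp add: ker_left_iff[OF assms(1,2)] biform_simps[OF assms(1)])

lemma ker_left_mono:
  assumes "psd B'" "\<And>x y. B' x x y y \<le> B x x y y"
  shows "ker_left B \<subseteq> ker_left B'"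
  using assms unfolding ker_left_def psd_def by (smt (verit) mem_Collect_eq subsetI)

lemma ker_left_decompose:
  fixes B :: "'a::euclidean_space \<Rightarrow> 'a \<Rightarrow> 'b::real_vector \<Rightarrow> 'b \<Rightarrow> real"
  assumes "biform B" "psd B"
  obtains k z where "k \<in> ker_left B" "\<And>k. k \<in> ker_left B \<Longrightarrow> z \<bullet> k = 0" "x = k + z"
proof -
  have "span (ker_left B) = ker_left B"
    using subspace_ker_left[OF assms] by (simp add: span_eq_iff)
  with orthogonal_subspace_decomp_exists[of "ker_left B" x] that show ?thesis
    unfolding orthogonal_def by metis
qed

text \<open>The largest possible multiple of the square of a product of two linear functionals is
  subtracted, each functional being orthogonal to the kernel in its variable. On unit vectors
  orthogonal to the kernels the remainder attains its minimum by compactness; a positive minimum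
  would leave room for a larger multiple.\<close>

lemma subtract_to_new_zero:
  fixes B :: "real^'m \<Rightarrow> real^'m \<Rightarrow> real^'n \<Rightarrow> real^'n \<Rightarrow> real"
  assumes B: "biform B" "psd B" and nz: "B u u v v \<noteq> 0"
  obtains B' g x1 y1 where "biform B'" "psd B'" "bilinear g"
    "\<And>x y. B x x y y = B' x x y y + (g x y)\<^sup>2"
    "x1 \<noteq> 0" "\<And>k. k \<in> ker_left B \<Longrightarrow> x1 \<bullet> k = 0"
    "y1 \<noteq> 0" "\<And>k. k \<in> ker_left (swap_form B) \<Longrightarrow> y1 \<bullet> k = 0" "B' x1 x1 y1 y1 = 0"
proof -
  note S = biform_swap[OF B(1)] psd_swap[OF B(2)]
  let ?K = "ker_left B" and ?L = "ker_left (swap_form B)"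
  \<comment> \<open>Only the components orthogonal to the kernels matter; they are nonzero because
    \<open>B u u v v\<close> is.\<close>
  obtain k p where p: "k \<in> ?K" "\<And>k. k \<in> ?K \<Longrightarrow> p \<bullet> k = 0" "u = k + p"
    using ker_left_decompose[OF B] by metis
  obtain k' q where q: "k' \<in> ?L" "\<And>k. k \<in> ?L \<Longrightarrow> q \<bullet> k = 0" "v = k' + q"
    using ker_left_decompose[OF S] by metis
  have "u \<notin> ?K" "v \<notin> ?L" using nz unfolding ker_left_def swap_form_def by blast+
  then have pq0: "p \<noteq> 0" "q \<noteq> 0" using p q by auto
  define g where "g = (\<lambda>x y. (p \<bullet> x) * (q \<bullet> y))"
  have g: "bilinear g" unfolding g_def bilinear_def linear_iff by (simp add: inner_simps algebra_simps)
  have gnz: "(\<lambda>(x,y). (g x y)\<^sup>2) (p,q) \<noteq> 0" using pq0 unfolding g_def by simp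
  obtain c where c: "0 \<le> c" "\<And>z. c * (\<lambda>(x,y). (g x y)\<^sup>2) z \<le> (\<lambda>(x,y). B x x y y) z"
     "\<And>e. e > 0 \<Longrightarrow> \<exists>z. (\<lambda>(x,y). B x x y y) z < (c + e) * (\<lambda>(x,y). (g x y)\<^sup>2) z"
    by (rule greatest_multiple_below[where f = "\<lambda>(x,y). (g x y)\<^sup>2" and g = "\<lambda>(x,y). B x x y y", OF _ _ gnz])
      (use B(2) in \<open>auto simp: psd_def\<close>)
  define B' where "B' = (\<lambda>x x' y y'. B x x' y y' - c * square_form g x x' y y')"
  have B'd: "B' x x y y = B x x y y - c * (g x y)\<^sup>2" for x y unfolding B'_def by simp
  have bB': "biform B'" unfolding B'_def by (rule biform_diff_square[OF B(1) g])
  have pB': "psd B'" using c(2) unfolding psd_def B'd by auto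
  define X where "X = {x. norm x = 1 \<and> (\<forall>k\<in>?K. x \<bullet> k = 0)}"
  define Y where "Y = {y. norm y = 1 \<and> (\<forall>k\<in>?L. y \<bullet> k = 0)}"
  have "compact X" "compact Y"
  proof -
    have "X = sphere 0 1 \<inter> (\<Inter>k\<in>?K. {x. x \<bullet> k = 0})" "Y = sphere 0 1 \<inter> (\<Inter>k\<in>?L. {x. x \<bullet> k = 0})"
      unfolding X_def Y_def by auto
    then show "compact X" "compact Y"
      by (auto intro!: compact_Int_closed closed_INT closed_Collect_eq continuous_intros)
  qed
  then have comp: "compact (X \<times> Y)" by (rule compact_Times)
  have ne: "X \<times> Y \<noteq> {}"
  proof -
    have "p /\<^sub>R norm p \<in> X" "q /\<^sub>R norm q \<in> Y" using pq0 p q unfolding X_def Y_def by auto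
    then show ?thesis by blast
  qed
  obtain m where m: "m \<in> X \<times> Y" "\<And>z. z \<in> X \<times> Y \<Longrightarrow>
      B' (fst m) (fst m) (snd m) (snd m) \<le> B' (fst z) (fst z) (snd z) (snd z)"
    using continuous_attains_inf[OF comp ne continuous_on_biform[OF bB']] by metis
  obtain x1 y1 where m1: "m = (x1,y1)" "x1 \<in> X" "y1 \<in> Y" using m(1) by auto
  define \<mu> where "\<mu> = B' x1 x1 y1 y1"
  have low: "\<mu> * (x \<bullet> x) * (y \<bullet> y) \<le> B' x x y y"
    if "\<And>k. k \<in> ?K \<Longrightarrow> x \<bullet> k = 0" "\<And>k. k \<in> ?L \<Longrightarrow> y \<bullet> k = 0" for x y
  proof (cases "x = 0 \<or> y = 0")
    case True
    then show ?thesis using biform_zero[OF bB'] by auto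
  next
    case False
    have "x /\<^sub>R norm x \<in> X" "y /\<^sub>R norm y \<in> Y" using False that unfolding X_def Y_def by auto
    then have "\<mu> \<le> B' (x /\<^sub>R norm x) (x /\<^sub>R norm x) (y /\<^sub>R norm y) (y /\<^sub>R norm y)"
      using m(2)[of "(x /\<^sub>R norm x, y /\<^sub>R norm y)"] unfolding m1 \<mu>_def by auto
    also have "\<dots> = B' x x y y / ((x \<bullet> x) * (y \<bullet> y))"
      by (simp add: biform_simps[OF bB'] divide_simps dot_square_norm power2_eq_square)
    finally show ?thesis using False by (simp add: field_simps)
  qed
  have "\<mu> = 0"
  proof (rule ccontr)
    assume "\<mu> \<noteq> 0"
    moreover have "\<mu> \<ge> 0" using pB' unfolding \<mu>_def psd_def by blast
    ultimately have \<mu>: "\<mu> > 0" by simp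
    \<comment> \<open>By Cauchy-Schwarz, \<open>e\<close> times the square of \<open>g\<close> is at
      most \<open>\<mu>\<close> times the squared norms of both arguments, so on the orthogonal
      complements it still fits below \<open>B'\<close>.\<close>
    define e where "e = \<mu> / ((p \<bullet> p) * (q \<bullet> q))"
    have "e > 0" using \<mu> pq0 unfolding e_def by simp
    from c(3)[OF this] obtain x y where xy: "B x x y y < (c + e) * (g x y)\<^sup>2" by auto
    obtain a x' where x': "a \<in> ?K" "\<And>k. k \<in> ?K \<Longrightarrow> x' \<bullet> k = 0" "x = a + x'"
      using ker_left_decompose[OF B] by metis
    obtain b y' where y': "b \<in> ?L" "\<And>k. k \<in> ?L \<Longrightarrow> y' \<bullet> k = 0" "y = b + y'"
      using ker_left_decompose[OF S] by metis
    \<comment> \<open>Neither \<open>B\<close> nor \<open>g\<close> sees the kernel components, so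
      the pair violating the bound may be moved into the orthogonal complements, where
      \<open>low\<close> applies.\<close>
    have Bxy: "B x x y y = B x' x' y' y'"
      using ker_left_shift[OF B x'(1), of x' y] ker_left_shift[OF S y'(1), of y' x']
      unfolding x'(3) y'(3) swap_form_def by simp
    have gxy: "g x y = g x' y'"
      using p(2)[OF x'(1)] q(2)[OF y'(1)] unfolding g_def x'(3) y'(3) by (simp add: inner_add_right)
    have "(g x' y')\<^sup>2 \<le> (p \<bullet> p) * (x' \<bullet> x') * ((q \<bullet> q) * (y' \<bullet> y'))"
      unfolding g_def power_mult_distrib by (intro mult_mono Cauchy_Schwarz_ineq) auto
    then have "e * (g x' y')\<^sup>2 \<le> e * ((p \<bullet> p) * (x' \<bullet> x') * ((q \<bullet> q) * (y' \<bullet> y')))"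
      using \<open>e > 0\<close> by simp
    also have "\<dots> = \<mu> * (x' \<bullet> x') * (y' \<bullet> y')"
      using pq0 unfolding e_def by (simp add: field_simps)
    also have "\<dots> \<le> B' x' x' y' y'" using low x'(2) y'(2) by blast
    finally show False using xy unfolding Bxy gxy B'd by (simp add: algebra_simps)
  qed
  have "bilinear (\<lambda>x y. sqrt c * g x y)" by (rule bilinear_scale_left[OF g])
  moreover have "B x x y y = B' x x y y + (sqrt c * g x y)\<^sup>2" for x y
    unfolding B'd using c(1) by (simp add: power_mult_distrib)
  moreover have "x1 \<noteq> 0" "y1 \<noteq> 0" using m1 unfolding X_def Y_def by auto
  ultimately show ?thesis
    using that[OF bB' pB', of "\<lambda>x y. sqrt c * g x y" x1 y1] m1 \<open>\<mu> = 0\<close>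
    unfolding X_def Y_def \<mu>_def by blast
qed

definition frame :: "real^3 \<Rightarrow> real^3 \<Rightarrow> real^3 \<Rightarrow> real^3 \<Rightarrow> real^3" where
  "frame u v w x = x$1 *\<^sub>R u + x$2 *\<^sub>R v + x$3 *\<^sub>R w"

lemma linear_frame: "linear (frame u v w)"
  unfolding frame_def linear_iff by (simp add: algebra_simps)

lemma frame_bij:
  assumes "\<And>a b c. a *\<^sub>R u + b *\<^sub>R v + c *\<^sub>R w = 0 \<Longrightarrow> a = 0 \<and> b = 0 \<and> c = 0"
  shows "bij (frame u v w)"
proof -
  have "x = 0" if "frame u v w x = 0" for x
    using assms[OF that[unfolded frame_def]] by (simp add: vec_eq_iff forall_3)
  then have "inj (frame u v w)"
    using linear_injective_0[OF linear_frame] by blast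
  then show ?thesis
    using linear_injective_imp_surjective[OF linear_frame] by (simp add: bij_def)
qed

text \<open>Two independent kernel vectors in dimension three leave rank at most one; orthogonality
  supplies the independence. The functional \<open>l\<close> is the normalised pairing with a vector
  \<open>v\<close> on which the form does not vanish.\<close>

lemma two_zeros_rank_one:
  fixes B :: "real^3 \<Rightarrow> real^3 \<Rightarrow> 'b::real_vector \<Rightarrow> 'b \<Rightarrow> real"
  assumes B: "biform B" "psd B" and z: "B x0 x0 y y = 0" "B x1 x1 y y = 0"
    and o: "x0 \<noteq> 0" "x1 \<noteq> 0" "x0 \<bullet> x1 = 0"
  obtains l where "linear l" "\<And>x. B x x y y = (l x)\<^sup>2"
proof (cases "\<forall>x. B x x y y = 0")
  case True
  then show ?thesis using that[of "\<lambda>x. 0"] by (simp add: linear_iff)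
next
  case False
  then obtain v where v: "B v v y y \<noteq> 0" by blast
  define d where "d = sqrt (B v v y y)"
  have "B v v y y \<ge> 0" using B(2) unfolding psd_def by blast
  then have d2: "d\<^sup>2 = B v v y y" unfolding d_def by simp
  have dn: "d \<noteq> 0" using d2 v by auto
  define l where "l = (\<lambda>x. B v x y y / d)"
  have l: "linear l" unfolding l_def linear_iff by (simp add: biform_simps[OF B(1)] add_divide_distrib)
  note k = psd_kernel_left[OF B z(1)] psd_kernel_left[OF B z(2)]
  have k': "B x x0 y y = 0" "B x x1 y y = 0" for x
    using k biform_sym(1)[OF B(1)] by metis+
  have "bij (frame v x0 x1)"
  proof (rule frame_bij)
    fix a b c assume h: "a *\<^sub>R v + b *\<^sub>R x0 + c *\<^sub>R x1 = 0"
    have "B v (a *\<^sub>R v + b *\<^sub>R x0 + c *\<^sub>R x1) y y = 0" unfolding h by (rule biform_zero[OF B(1)])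
    then have a: "a = 0" using v by (simp add: biform_simps[OF B(1)] k')
    have "x0 \<bullet> (b *\<^sub>R x0 + c *\<^sub>R x1) = 0" "x1 \<bullet> (b *\<^sub>R x0 + c *\<^sub>R x1) = 0" using h a by auto
    then show "a = 0 \<and> b = 0 \<and> c = 0" using a o by (simp add: inner_simps inner_commute)
  qed
  have "B x x y y = (l x)\<^sup>2" for x
  proof -
    obtain t where t: "x = frame v x0 x1 t" using \<open>bij _\<close> by (meson bij_pointE)
    show ?thesis unfolding t frame_def l_def
      using dn by (simp add: biform_simps[OF B(1)] k k' d2[symmetric] power2_eq_square)
  qed
  then show ?thesis using that l by blast
qed

text \<open>A form that ignores the direction \<open>x0\<close> is in effect a form with only two
  variables on the left. The induction is on the codimension of the kernel in \<open>y\<close>: each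
  round splits off two squares and enlarges that kernel.\<close>

lemma sos_if_ker_left_nontrivial:
  fixes B :: "real^3 \<Rightarrow> real^3 \<Rightarrow> real^'n \<Rightarrow> real^'n \<Rightarrow> real"
  assumes "biform B" "psd B" "x0 \<noteq> 0" "x0 \<in> ker_left B"
  shows "sos B"
  using assms
proof (induction "CARD('n) - dim (ker_left (swap_form B))" arbitrary: B rule: less_induct)
  case less
  note B = less.prems(1,2)
  note S = biform_swap[OF B(1)] psd_swap[OF B(2)]
  show ?case
  proof (cases "\<forall>x y. B x x y y = 0")
    case True
    then have "(\<forall>g\<in>set []. bilinear g) \<and> (\<forall>x y. B x x y y = (\<Sum>g\<leftarrow>[]. (g x y)\<^sup>2))" by simp
    then show ?thesis unfolding sos_def by blast
  next
    case False
    then obtain u v where nz: "B u u v v \<noteq> 0" by blast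
    obtain B' g x1 y1 where B': "biform B'" "psd B'" "bilinear g"
        "\<And>x y. B x x y y = B' x x y y + (g x y)\<^sup>2"
      and x1: "x1 \<noteq> 0" "\<And>k. k \<in> ker_left B \<Longrightarrow> x1 \<bullet> k = 0"
      and y1: "y1 \<noteq> 0" "\<And>k. k \<in> ker_left (swap_form B) \<Longrightarrow> y1 \<bullet> k = 0" and z: "B' x1 x1 y1 y1 = 0"
      by (rule subtract_to_new_zero[OF B nz], rule that)
    have le: "B' x x y y \<le> B x x y y" for x y unfolding B'(4) by simp
    have x0': "x0 \<in> ker_left B'" using ker_left_mono[where B = B and B' = B', OF B'(2) le] less.prems(4) by blast
    then have z0: "B' x0 x0 y1 y1 = 0" unfolding ker_left_def by blast
    \<comment> \<open>The new zero direction is independent of \<open>x0\<close>, so at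
      \<open>y1\<close> the form in \<open>x\<close> has two independent kernel vectors and rank at
      most one.\<close>
    have "x0 \<bullet> x1 = 0" using x1(2)[OF less.prems(4)] by (simp add: inner_commute)
    from two_zeros_rank_one[OF B'(1,2) z0 z less.prems(3) x1(1) this]
    obtain l where l: "linear l" "\<And>x. B' x x y1 y1 = (l x)\<^sup>2" by blast
    have l': "swap_form B' y1 y1 x x = (l x)\<^sup>2" for x unfolding swap_form_def by (rule l(2))
    \<comment> \<open>The Schur complement is taken with the variables exchanged and puts
      \<open>y1\<close> into the kernel in \<open>y\<close>.\<close>
    from schur_complement[OF biform_swap[OF B'(1)] psd_swap[OF B'(2)] l(1) l']
    obtain B1 h where B1: "biform B1" "psd B1" "bilinear h" "\<And>x. B1 y1 y1 x x = 0"
      "\<And>y x. swap_form B' y y x x = B1 y y x x + (h y x)\<^sup>2" by blast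
    let ?B2 = "swap_form B1"
    have B2: "biform ?B2" "psd ?B2" using biform_swap psd_swap B1 by blast+
    have e2: "B' x x y y = ?B2 x x y y + ((\<lambda>x y. h y x) x y)\<^sup>2" for x y
      using B1(5)[of y x] unfolding swap_form_def by simp
    have le2: "?B2 x x y y \<le> B x x y y" for x y unfolding B'(4) e2 by simp
    have x0'': "x0 \<in> ker_left ?B2" using ker_left_mono[where B = B and B' = ?B2, OF B2(2) le2] less.prems(4) by blast
    have sub: "ker_left (swap_form B) \<subseteq> ker_left B1"
      by (rule ker_left_mono[where B = "swap_form B" and B' = B1, OF B1(2)]) (use le2 in \<open>simp add: swap_form_def\<close>)
    have "y1 \<in> ker_left B1" using B1(4) unfolding ker_left_def by blast
    \<comment> \<open>Being nonzero and orthogonal to the old kernel, \<open>y1\<close> enlarges it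
      strictly.\<close>
    moreover have "y1 \<notin> ker_left (swap_form B)" using y1 by force
    ultimately have "ker_left (swap_form B) \<subset> ker_left B1" using sub by blast
    then have "dim (ker_left (swap_form B)) < dim (ker_left B1)"
      by (intro dim_psubset)
        (simp add: span_eq_iff[THEN iffD2, OF subspace_ker_left[OF S]]
          span_eq_iff[THEN iffD2, OF subspace_ker_left[OF B1(1,2)]])
    moreover have "dim (ker_left B1) \<le> CARD('n)"
      using dim_subset_UNIV[of "ker_left B1"] by simp
    ultimately have "sos ?B2"
      using less.hyps[OF _ B2 less.prems(3) x0''] by (simp add: diff_less_mono2)
    then have "sos B'" using sos_add_square[where B = B' and B' = ?B2, OF _ bilinear_flip[OF B1(3)] e2] by blast
    then show ?thesis using sos_add_square[where B = B and B' = B', OF _ B'(3,4)] by blast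
  qed
qed

text \<open>One Schur complement moves \<open>x0\<close> into the kernel and leaves the case already
  settled.\<close>

lemma sos_if_rank_one_left:
  fixes B :: "real^3 \<Rightarrow> real^3 \<Rightarrow> real^'n \<Rightarrow> real^'n \<Rightarrow> real"
  assumes "biform B" "psd B" "x0 \<noteq> 0" "linear l" "\<And>y. B x0 x0 y y = (l y)\<^sup>2"
  shows "sos B"
proof -
  from schur_complement[OF assms(1,2,4,5)] obtain B' g where B': "biform B'" "psd B'" "bilinear g"
    "\<And>y. B' x0 x0 y y = 0" "\<And>x y. B x x y y = B' x x y y + (g x y)\<^sup>2" by blast
  then have "x0 \<in> ker_left B'" unfolding ker_left_def by blast
  from sos_if_ker_left_nontrivial[OF B'(1,2) assms(3) this] show ?thesis
    using sos_add_square[where B = B and B' = B', OF _ B'(3,5)] by blast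
qed

lemma sos_if_rank_one_right:
  fixes B :: "real^'n \<Rightarrow> real^'n \<Rightarrow> real^3 \<Rightarrow> real^3 \<Rightarrow> real"
  assumes "biform B" "psd B" "y0 \<noteq> 0" "linear l" "\<And>x. B x x y0 y0 = (l x)\<^sup>2"
  shows "sos B"
proof -
  have "swap_form B y0 y0 x x = (l x)\<^sup>2" for x by (simp add: swap_form_def assms(5))
  from sos_swap[OF sos_if_rank_one_left[OF biform_swap[OF assms(1)] psd_swap[OF assms(2)] assms(3,4) this]]
  show ?thesis by simp
qed

section \<open>Density and coefficient comparison\<close>

text \<open>On the line from \<open>x\<close> to \<open>u\<close> the polynomial has finitely many
  roots, so \<open>x\<close> is a limit of points where \<open>P\<close> does not vanish; continuity
  of \<open>h\<close> carries the inequality over.\<close>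

lemma polynomial_nonneg_by_density:
  fixes P h :: "'a::euclidean_space \<Rightarrow> real"
  assumes P: "real_polynomial_function P" "P u \<noteq> 0" and h: "continuous_on UNIV h"
    and nn: "\<And>x. P x \<noteq> 0 \<Longrightarrow> 0 \<le> h x"
  shows "0 \<le> h x"
proof -
  define L where "L = (\<lambda>t::real. x + t *\<^sub>R (u - x))"
  have "polynomial_function L" unfolding L_def
    by (intro polynomial_function_add polynomial_function_const polynomial_function_mult
        polynomial_function_id)
  then have "real_polynomial_function (P \<circ> L)"
    using real_polynomial_function_compose P(1) by blast
  then obtain c n where c: "\<And>t. P (L t) = (\<Sum>i\<le>n. c i * t ^ i)"
    using real_polynomial_function_iff_sum[of "P \<circ> L"] by (auto simp: fun_eq_iff)
  have "P (L 1) \<noteq> 0" using P(2) by (simp add: L_def)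
  then have "\<exists>i\<le>n. c i \<noteq> 0" unfolding c by (metis (no_types, lifting) atMost_iff mult_zero_left sum.neutral)
  then have fin: "finite {t. P (L t) = 0}" unfolding c using polyfun_finite_roots[of c n] by auto
  have "\<forall>\<^sub>F t in at 0. P (L t) \<noteq> 0"
  proof -
    have "open (- ({t. P (L t) = 0} - {0}))" using fin by (intro open_Compl finite_imp_closed) auto
    then show ?thesis unfolding eventually_at_topological by (intro exI[of _ "- ({t. P (L t) = 0} - {0})"]) auto
  qed
  then have ev: "\<forall>\<^sub>F t in at 0. 0 \<le> h (L t)" by (rule eventually_mono) (rule nn)
  have "isCont (\<lambda>t. h (L t)) 0"
    by (rule continuous_at_compose[unfolded comp_def])
      (use h in \<open>auto simp: L_def continuous_on_eq_continuous_at intro!: continuous_intros\<close>)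
  then have "((\<lambda>t. h (L t)) \<longlongrightarrow> h (L 0)) (at 0)" unfolding isCont_def .
  then have "0 \<le> h (L 0)" using ev by (rule tendsto_lowerbound) simp
  then show ?thesis by (simp add: L_def)
qed

text \<open>Degree six is the highest that occurs below; comparisons of lower degree are padded with
  zero coefficients.\<close>

lemma polynomial_coeffs_zero:
  fixes c0 c1 c2 c3 c4 c5 c6 :: real
  assumes "\<And>x. c0 + c1 * x + c2 * x^2 + c3 * x^3 + c4 * x^4 + c5 * x^5 + c6 * x^6 = 0"
  shows "c0 = 0" "c1 = 0" "c2 = 0" "c3 = 0" "c4 = 0" "c5 = 0" "c6 = 0"
proof -
  have "\<forall>x. (\<Sum>i\<le>6. ((!) [c0,c1,c2,c3,c4,c5,c6] i) * x ^ i) = 0"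
    using assms by (simp add: eval_nat_numeral)
  then have "\<forall>i\<le>6. [c0,c1,c2,c3,c4,c5,c6] ! i = 0" by (subst (asm) polyfun_eq_0) 
  from this[rule_format, of 0] this[rule_format, of 1] this[rule_format, of 2] this[rule_format, of 3]
    this[rule_format, of 4] this[rule_format, of 5] this[rule_format, of 6]
  show "c0 = 0" "c1 = 0" "c2 = 0" "c3 = 0" "c4 = 0" "c5 = 0" "c6 = 0" by simp_all
qed

text \<open>For \<open>A > 0\<close>, completing the square writes \<open>A\<close> times the form
  as a square plus the determinant times the square of \<open>t\<close>; at a nontrivial zero both
  summands vanish and \<open>t\<close> does not.\<close>

lemma singular_binary_form:
  fixes A B C :: real
  assumes nn: "\<And>s t. 0 \<le> A * s\<^sup>2 + 2 * B * s * t + C * t\<^sup>2"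
    and z: "A * s\<^sup>2 + 2 * B * s * t + C * t\<^sup>2 = 0" "(s, t) \<noteq> (0, 0)"
  shows "A * C = B\<^sup>2"
proof (cases "A = 0")
  case True
  have "2 * B = 0"
  proof (rule quadratic_nonneg_linear_zero)
    show "0 \<le> 2 * B * t + C * t\<^sup>2" for t using nn[of 1 t] True by simp
  qed
  then show ?thesis using True by simp
next
  case False
  have A: "A > 0" using nn[of 1 0] False by simp
  have "0 \<le> A * (-B)\<^sup>2 + 2 * B * (-B) * A + C * A\<^sup>2" by (rule nn)
  also have "\<dots> = A * (A * C - B\<^sup>2)" by (simp add: power2_eq_square algebra_simps)
  finally have d: "A * C - B\<^sup>2 \<ge> 0" using A by (simp add: zero_le_mult_iff)
  have "(A * s + B * t)\<^sup>2 + (A * C - B\<^sup>2) * t\<^sup>2 = A * (A * s\<^sup>2 + 2 * B * s * t + C * t\<^sup>2)"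
    by (simp add: power2_eq_square algebra_simps)
  also have "\<dots> = 0" using z(1) by simp
  finally have e: "(A * s + B * t)\<^sup>2 + (A * C - B\<^sup>2) * t\<^sup>2 = 0" .
  then have 1: "(A * s + B * t)\<^sup>2 = 0" "(A * C - B\<^sup>2) * t\<^sup>2 = 0"
    using d by (auto simp: add_nonneg_eq_0_iff)
  then have "t \<noteq> 0" using z(2) A by auto
  then show ?thesis using 1(2) by simp
qed

text \<open>Completing the square in \<open>x\<close> leaves a binary form in \<open>(s, t)\<close>
  whose coefficients are quadratic in \<open>z\<close>. Singularity for every \<open>z\<close> makes
  its determinant vanish identically, and the coefficient of \<open>z^4\<close> there is
  \<open>r * (r - m2^2 - m3^2)\<close>.\<close>

lemma singular_pencil_isometry:
  fixes r m2 m3 :: real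
  assumes r: "r > 0"
    and f: "\<And>x s t z. f x s t z = r * x\<^sup>2 + 2 * x * (z * (m2 * s + m3 * t) + n2 * s + n3 * t)
      + z\<^sup>2 * (s\<^sup>2 + t\<^sup>2) + z * (a22 * s\<^sup>2 + 2 * a23 * s * t + a33 * t\<^sup>2)
      + b22 * s\<^sup>2 + 2 * b23 * s * t + b33 * t\<^sup>2"
    and nn: "\<And>x s t z. 0 \<le> f x s t z"
    and sing: "\<And>z. \<exists>x s t. (x, s, t) \<noteq> (0, 0, 0) \<and> f x s t z = 0"
  shows "m2\<^sup>2 + m3\<^sup>2 = r"
proof -
  define A where "A z = z\<^sup>2 * (r - m2\<^sup>2) + z * (r * a22 - 2 * m2 * n2) + (r * b22 - n2\<^sup>2)" for z
  define B where "B z = - z\<^sup>2 * m2 * m3 + z * (r * a23 - m2 * n3 - m3 * n2) + (r * b23 - n2 * n3)" for z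
  define C where "C z = z\<^sup>2 * (r - m3\<^sup>2) + z * (r * a33 - 2 * m3 * n3) + (r * b33 - n3\<^sup>2)" for z
  have id: "r * f x s t z = (r * x + z * (m2 * s + m3 * t) + n2 * s + n3 * t)\<^sup>2
      + (A z * s\<^sup>2 + 2 * B z * s * t + C z * t\<^sup>2)" for x s t z
    unfolding f A_def B_def C_def by (simp add: power2_eq_square algebra_simps)
  have F: "0 \<le> A z * s\<^sup>2 + 2 * B z * s * t + C z * t\<^sup>2" for s t z
  proof -
    \<comment> \<open>The minimising \<open>x\<close>, at which the completed square
      vanishes.\<close>
    define x where "x = - (z * (m2 * s + m3 * t) + n2 * s + n3 * t) / r"
    have e: "r * x + z * (m2 * s + m3 * t) + n2 * s + n3 * t = 0" using r unfolding x_def by simp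
    have "0 \<le> r * f x s t z" using r nn by simp
    then show ?thesis unfolding id e by simp
  qed
  have AC: "A z * C z = (B z)\<^sup>2" for z
  proof -
    obtain x s t where x: "(x, s, t) \<noteq> (0, 0, 0)" "f x s t z = 0" using sing by blast
    have 0: "(r * x + z * (m2 * s + m3 * t) + n2 * s + n3 * t)\<^sup>2
      + (A z * s\<^sup>2 + 2 * B z * s * t + C z * t\<^sup>2) = 0" unfolding id[symmetric] x(2) by simp
    have z1: "(r * x + z * (m2 * s + m3 * t) + n2 * s + n3 * t)\<^sup>2 = 0"
      and z2: "A z * s\<^sup>2 + 2 * B z * s * t + C z * t\<^sup>2 = 0"
      using 0 F[of z s t] zero_le_power2[of "r * x + z * (m2 * s + m3 * t) + n2 * s + n3 * t"]
      by linarith+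
    have "(s, t) \<noteq> (0, 0)" using z1 x(1) r by auto
    from singular_binary_form[OF F z2 this] show ?thesis .
  qed
  \<comment> \<open>\<open>d0\<close> to \<open>d3\<close> are the coefficients of
    \<open>z^0\<close> to \<open>z^3\<close> in \<open>A z * C z - (B z)^2\<close>; the next
    coefficient carries the claim.\<close>
  define d0 where "d0 = (r * b22 - n2\<^sup>2) * (r * b33 - n3\<^sup>2) - (r * b23 - n2 * n3)\<^sup>2"
  define d1 where "d1 = (r * a22 - 2 * m2 * n2) * (r * b33 - n3\<^sup>2) + (r * b22 - n2\<^sup>2) * (r * a33 - 2 * m3 * n3)
    - 2 * (r * a23 - m2 * n3 - m3 * n2) * (r * b23 - n2 * n3)"
  define d2 where "d2 = (r - m2\<^sup>2) * (r * b33 - n3\<^sup>2) + (r * a22 - 2 * m2 * n2) * (r * a33 - 2 * m3 * n3)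
    + (r * b22 - n2\<^sup>2) * (r - m3\<^sup>2) - (r * a23 - m2 * n3 - m3 * n2)\<^sup>2 + 2 * m2 * m3 * (r * b23 - n2 * n3)"
  define d3 where "d3 = (r - m2\<^sup>2) * (r * a33 - 2 * m3 * n3) + (r * a22 - 2 * m2 * n2) * (r - m3\<^sup>2)
    + 2 * m2 * m3 * (r * a23 - m2 * n3 - m3 * n2)"
  have "d0 + d1 * z + d2 * z^2 + d3 * z^3 + ((r - m2\<^sup>2) * (r - m3\<^sup>2) - (m2 * m3)\<^sup>2) * z^4
      + 0 * z^5 + 0 * z^6 = 0" for z
  proof -
    have "d0 + d1 * z + d2 * z^2 + d3 * z^3 + ((r - m2\<^sup>2) * (r - m3\<^sup>2) - (m2 * m3)\<^sup>2) * z^4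
      + 0 * z^5 + 0 * z^6 = A z * C z - (B z)\<^sup>2"
      unfolding A_def B_def C_def d0_def d1_def d2_def d3_def by algebra
    then show ?thesis using AC by simp
  qed
  from polynomial_coeffs_zero(5)[OF this] have "r * (r - (m2\<^sup>2 + m3\<^sup>2)) = 0"
    by (simp add: power2_eq_square algebra_simps)
  then show ?thesis using r by simp
qed

text \<open>The intermediate value theorem on the upper half circle from \<open>(1, 0)\<close> to
  \<open>(-1, 0)\<close>, whose end values are opposite.\<close>

lemma odd_form_root:
  fixes h :: "real \<Rightarrow> real \<Rightarrow> real"
  assumes "continuous_on UNIV (\<lambda>t. h (cos t) (sin t))" "h (-1) 0 = - h 1 0"
  obtains a b where "(a, b) \<noteq> (0, 0)" "h a b = 0"
proof -
  let ?f = "\<lambda>t. h (cos t) (sin t)"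
  have c: "continuous_on {0..pi} ?f" using assms(1) continuous_on_subset by blast
  have "\<exists>t. ?f t = 0"
  proof (cases "h 1 0 \<le> 0")
    case True
    then show ?thesis using IVT'[of ?f 0 0 pi] c assms(2) by auto
  next
    case False
    then show ?thesis using IVT2'[of ?f pi 0 0] c assms(2) by auto
  qed
  then obtain t where "h (cos t) (sin t) = 0" by blast
  moreover have "(cos t, sin t) \<noteq> (0, 0)" 
    by (metis Pair_inject add.right_neutral power_zero_numeral sin_cos_squared_add zero_neq_one)
  ultimately show ?thesis using that by blast
qed

section \<open>The normal form at a zero\<close>

text \<open>With \<open>w = z + c0 * a + c1 * b\<close>, the expressions
  \<open>a * x + w * s\<close>, \<open>b * x + w * t\<close> and \<open>a * t - b * s\<close> are,
  up to sign, the components of the cross product of \<open>(x, s, t)\<close> and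
  \<open>(-w, a, b)\<close>; the conclusion is a nonnegative quadratic form in that product. After
  the square in \<open>x\<close> is completed, nonnegativity and singularity for all
  \<open>z\<close> determine the remaining coefficients, while \<open>rank\<close> rules out a cubic
  \<open>L1\<close> that is not identically zero.\<close>

lemma normal_form:
  fixes p1 p2 p3 q1 q2 q3 u1 u2 v1 v2 w1 w2 b11 b12 b13 b21 b22 b23 b31 b32 b33 :: real
  assumes f: "\<And>x s t a b z. f x s t a b z = (a\<^sup>2 + b\<^sup>2) * x\<^sup>2
      + 2 * x * (z * (a * s + b * t) + (p1 * a\<^sup>2 + p2 * a * b + p3 * b\<^sup>2) * s + (q1 * a\<^sup>2 + q2 * a * b + q3 * b\<^sup>2) * t)
      + z\<^sup>2 * (s\<^sup>2 + t\<^sup>2) + z * ((u1 * a + u2 * b) * s\<^sup>2 + 2 * (v1 * a + v2 * b) * s * t + (w1 * a + w2 * b) * t\<^sup>2)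
      + (b11 * a\<^sup>2 + b12 * a * b + b13 * b\<^sup>2) * s\<^sup>2 + 2 * (b21 * a\<^sup>2 + b22 * a * b + b23 * b\<^sup>2) * s * t
      + (b31 * a\<^sup>2 + b32 * a * b + b33 * b\<^sup>2) * t\<^sup>2"
    and nn: "\<And>x s t a b z. 0 \<le> f x s t a b z"
    and sing: "\<And>a b z. (a, b) \<noteq> (0, 0) \<Longrightarrow> \<exists>x s t. (x, s, t) \<noteq> (0, 0, 0) \<and> f x s t a b z = 0"
    and rank: "\<And>a b z. (a, b) \<noteq> (0, 0) \<Longrightarrow> \<exists>x s t. (a\<^sup>2 + b\<^sup>2) * f x s t a b z \<noteq>
      ((a\<^sup>2 + b\<^sup>2) * x + z * (a * s + b * t) + (p1 * a\<^sup>2 + p2 * a * b + p3 * b\<^sup>2) * s + (q1 * a\<^sup>2 + q2 * a * b + q3 * b\<^sup>2) * t)\<^sup>2"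
  obtains c0 c1 k1 k2 c where "0 \<le> c"
    "\<And>x s t a b z. f x s t a b z = (a * x + (z + c0 * a + c1 * b) * s + k1 * (a * t - b * s))\<^sup>2
      + (b * x + (z + c0 * a + c1 * b) * t - k2 * (a * t - b * s))\<^sup>2 + c * (a * t - b * s)\<^sup>2"
proof -
  define r where "r a b = a\<^sup>2 + b\<^sup>2" for a b :: real
  define n2 where "n2 a b = p1 * a\<^sup>2 + p2 * a * b + p3 * b\<^sup>2" for a b
  define n3 where "n3 a b = q1 * a\<^sup>2 + q2 * a * b + q3 * b\<^sup>2" for a b
  define \<alpha>22 where "\<alpha>22 a b = u1 * a + u2 * b" for a b
  define \<alpha>23 where "\<alpha>23 a b = v1 * a + v2 * b" for a b
  define \<alpha>33 where "\<alpha>33 a b = w1 * a + w2 * b" for a b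
  define \<beta>22 where "\<beta>22 a b = b11 * a\<^sup>2 + b12 * a * b + b13 * b\<^sup>2" for a b
  define \<beta>23 where "\<beta>23 a b = b21 * a\<^sup>2 + b22 * a * b + b23 * b\<^sup>2" for a b
  define \<beta>33 where "\<beta>33 a b = b31 * a\<^sup>2 + b32 * a * b + b33 * b\<^sup>2" for a b
  \<comment> \<open>\<open>nt\<close> and \<open>nu\<close> are the inner products of
    \<open>(n2, n3)\<close> with \<open>(a, b)\<close> and \<open>(-b, a)\<close>. Once the square
    of \<open>M\<close> is removed from \<open>r\<close> times \<open>f\<close>, the
    \<open>L\<close> and \<open>K\<close> terms give the parts of first and zeroth order in
    \<open>z\<close> of the remaining binary form, the former up to the factor
    \<open>r\<close>.\<close>
  define nt where "nt a b = n2 a b * a + n3 a b * b" for a b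
  define nu where "nu a b = n3 a b * a - n2 a b * b" for a b
  define L0 where "L0 a b = \<alpha>22 a b * a\<^sup>2 + 2 * \<alpha>23 a b * a * b + \<alpha>33 a b * b\<^sup>2 - 2 * nt a b" for a b
  define L1 where "L1 a b = (\<alpha>33 a b - \<alpha>22 a b) * a * b + \<alpha>23 a b * (a\<^sup>2 - b\<^sup>2) - nu a b" for a b
  define L2 where "L2 a b = \<alpha>22 a b * b\<^sup>2 - 2 * \<alpha>23 a b * a * b + \<alpha>33 a b * a\<^sup>2" for a b
  define K0 where "K0 a b = r a b * (\<beta>22 a b * a\<^sup>2 + 2 * \<beta>23 a b * a * b + \<beta>33 a b * b\<^sup>2) - (nt a b)\<^sup>2" for a b
  define K1 where "K1 a b = r a b * ((\<beta>33 a b - \<beta>22 a b) * a * b + \<beta>23 a b * (a\<^sup>2 - b\<^sup>2)) - nt a b * nu a b" for a b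
  define K2 where "K2 a b = r a b * (\<beta>22 a b * b\<^sup>2 - 2 * \<beta>23 a b * a * b + \<beta>33 a b * a\<^sup>2) - (nu a b)\<^sup>2" for a b
  define M where "M x s t a b z = r a b * x + z * (a * s + b * t) + n2 a b * s + n3 a b * t" for x s t a b z
  define B where "B a b z = r a b * z * L1 a b + K1 a b" for a b z
  define C where "C a b z = z\<^sup>2 * (r a b)\<^sup>2 + r a b * z * L2 a b + K2 a b" for a b z
  have f': "f x s t a b z = r a b * x\<^sup>2 + 2 * x * (z * (a * s + b * t) + n2 a b * s + n3 a b * t)
    + z\<^sup>2 * (s\<^sup>2 + t\<^sup>2) + z * (\<alpha>22 a b * s\<^sup>2 + 2 * \<alpha>23 a b * s * t + \<alpha>33 a b * t\<^sup>2)
    + \<beta>22 a b * s\<^sup>2 + 2 * \<beta>23 a b * s * t + \<beta>33 a b * t\<^sup>2" for x s t a b z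
    unfolding f r_def n2_def n3_def \<alpha>22_def \<alpha>23_def \<alpha>33_def \<beta>22_def \<beta>23_def \<beta>33_def by simp
  \<comment> \<open>the vector \<open>(s, t)\<close> is written in the orthogonal basis \<open>(a, b)\<close>, \<open>(-b, a)\<close>\<close>
  have id: "r a b * f x (\<sigma> * a - \<rho> * b) (\<sigma> * b + \<rho> * a) a b z = (M x (\<sigma> * a - \<rho> * b) (\<sigma> * b + \<rho> * a) a b z)\<^sup>2
     + ((r a b * z * L0 a b + K0 a b) * \<sigma>\<^sup>2 + 2 * B a b z * \<sigma> * \<rho> + C a b z * \<rho>\<^sup>2)" for x \<sigma> \<rho> a b z
    unfolding f' M_def B_def C_def L0_def L1_def L2_def K0_def K1_def K2_def nt_def nu_def r_def
    by algebra
  have rpos: "r a b > 0" if "(a, b) \<noteq> (0, 0)" for a b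
    using that unfolding r_def by (auto simp: sum_power2_gt_zero_iff)
  have F: "0 \<le> (r a b * z * L0 a b + K0 a b) * \<sigma>\<^sup>2 + 2 * B a b z * \<sigma> * \<rho> + C a b z * \<rho>\<^sup>2"
    if ab: "(a, b) \<noteq> (0, 0)" for a b z \<sigma> \<rho>
  proof -
    define s t where "s = \<sigma> * a - \<rho> * b" and "t = \<sigma> * b + \<rho> * a"
    define x where "x = - (z * (a * s + b * t) + n2 a b * s + n3 a b * t) / r a b"
    have "M x s t a b z = 0" using rpos[OF ab] unfolding x_def M_def by simp
    moreover have "0 \<le> r a b * f x s t a b z" using rpos[OF ab] nn by simp
    ultimately show ?thesis using id[of a b x \<sigma> \<rho> z] unfolding s_def t_def by simp
  qed
  \<comment> \<open>The coefficient of \<open>\<sigma>\<close> squared is affine in \<open>z\<close>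
    and nonnegative for all \<open>z\<close>, so its slope vanishes.\<close>
  have L0: "L0 a b = 0" if ab: "(a, b) \<noteq> (0, 0)" for a b
  proof (rule ccontr)
    assume n: "L0 a b \<noteq> 0"
    have "0 \<le> r a b * z * L0 a b + K0 a b" for z using F[OF ab, of z 1 0] by simp
    from this[of "(- K0 a b - 1) / (r a b * L0 a b)"] show False using n rpos[OF ab] by simp
  qed
  have decomp: "\<exists>\<sigma> \<rho>. s = \<sigma> * a - \<rho> * b \<and> t = \<sigma> * b + \<rho> * a" if ab: "(a, b) \<noteq> (0, 0)" for a b s t :: real
  proof -
    have "r a b \<noteq> 0" using rpos[OF ab] by simp
    then have "s = ((a * s + b * t) / r a b) * a - ((a * t - b * s) / r a b) * b"
       "t = ((a * s + b * t) / r a b) * b + ((a * t - b * s) / r a b) * a"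
      by (simp_all add: field_simps) (simp_all add: r_def power2_eq_square algebra_simps)
    then show ?thesis by blast
  qed
  \<comment> \<open>A nontrivial zero of \<open>f\<close> gives one of the binary form: with
    \<open>\<sigma> = \<rho> = 0\<close>, vanishing of \<open>M\<close> would force
    \<open>x = 0\<close> as well.\<close>
  have KC: "K0 a b * C a b z = (B a b z)\<^sup>2" if ab: "(a, b) \<noteq> (0, 0)" for a b z
  proof -
    note F' = F[OF ab, of z, unfolded L0[OF ab] mult_zero_right add_0_left]
    obtain x s t where x: "(x, s, t) \<noteq> (0, 0, 0)" "f x s t a b z = 0" using sing[OF ab] by blast
    obtain \<sigma> \<rho> where st: "s = \<sigma> * a - \<rho> * b" "t = \<sigma> * b + \<rho> * a" using decomp[OF ab] by blast
    have 0: "(M x s t a b z)\<^sup>2 + (K0 a b * \<sigma>\<^sup>2 + 2 * B a b z * \<sigma> * \<rho> + C a b z * \<rho>\<^sup>2) = 0"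
      using id[of a b x \<sigma> \<rho> z] x(2) L0[OF ab] unfolding st by simp
    have z1: "(M x s t a b z)\<^sup>2 = 0" and z2: "K0 a b * \<sigma>\<^sup>2 + 2 * B a b z * \<sigma> * \<rho> + C a b z * \<rho>\<^sup>2 = 0"
      using 0 F'[of \<sigma> \<rho>] zero_le_power2[of "M x s t a b z"] by linarith+
    have "(\<sigma>, \<rho>) \<noteq> (0, 0)" using z1 x(1) rpos[OF ab] unfolding st M_def by auto
    from singular_binary_form[OF F' z2 this] show ?thesis .
  qed
  \<comment> \<open>Comparison of the coefficients of 1, \<open>z\<close> and \<open>z^2\<close> in
    \<open>KC\<close>.\<close>
  have K: "K0 a b = (L1 a b)\<^sup>2" "K0 a b * L2 a b = 2 * L1 a b * K1 a b" "K0 a b * K2 a b = (K1 a b)\<^sup>2"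
    if ab: "(a, b) \<noteq> (0, 0)" for a b
  proof -
    have "(K0 a b * K2 a b - (K1 a b)\<^sup>2) + r a b * (K0 a b * L2 a b - 2 * L1 a b * K1 a b) * z
      + (r a b)\<^sup>2 * (K0 a b - (L1 a b)\<^sup>2) * z^2 + 0 * z^3 + 0 * z^4 + 0 * z^5 + 0 * z^6 = 0" for z
      using KC[OF ab, of z] unfolding B_def C_def by algebra
    from polynomial_coeffs_zero(1,2,3)[OF this] rpos[OF ab] show "K0 a b = (L1 a b)\<^sup>2"
      "K0 a b * L2 a b = 2 * L1 a b * K1 a b" "K0 a b * K2 a b = (K1 a b)\<^sup>2" by auto
  qed
  note defs = L1_def L2_def K0_def K1_def K2_def nt_def nu_def r_def n2_def n3_def
    \<alpha>22_def \<alpha>23_def \<alpha>33_def \<beta>22_def \<beta>23_def \<beta>33_def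
  \<comment> \<open>\<open>L1\<close> is a cubic in \<open>(a, b)\<close> and so has a nontrivial
    real root. If it is not identically zero, the identity \<open>disc\<close> extends to that root
    by density; there \<open>C\<close> has a double root in \<open>z\<close>, at which
    \<open>r\<close> times \<open>f\<close> is the bare square of \<open>M\<close>, contrary to
    \<open>rank\<close>.\<close>
  have L1: "L1 a b = 0" for a b
  proof (rule ccontr)
    assume n: "L1 a b \<noteq> 0"
    obtain a1 b1 where ab1: "(a1, b1) \<noteq> (0, 0)" and root: "L1 a1 b1 = 0"
    proof (rule odd_form_root[of L1])
      show "continuous_on UNIV (\<lambda>t. L1 (cos t) (sin t))" unfolding defs by (intro continuous_intros)
      show "L1 (- 1) 0 = - L1 1 0" unfolding defs by simp
    qed
    \<comment> \<open>Up to the factor \<open>r^2\<close>, this says that the discriminant of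
      \<open>C\<close> as a polynomial in \<open>z\<close> is zero.\<close>
    have disc: "(L2 a b)\<^sup>2 = 4 * K2 a b" if nz: "L1 a b \<noteq> 0" for a b
    proof -
      have ab: "(a, b) \<noteq> (0, 0)" using nz unfolding defs by auto
      have 1: "L1 a b * L2 a b = 2 * K1 a b" "(L1 a b)\<^sup>2 * K2 a b = (K1 a b)\<^sup>2"
        using K[OF ab] nz by (auto simp: power2_eq_square)
      have "(L1 a b)\<^sup>2 * ((L2 a b)\<^sup>2 - 4 * K2 a b) = (L1 a b * L2 a b)\<^sup>2 - 4 * ((L1 a b)\<^sup>2 * K2 a b)"
        by algebra
      also have "\<dots> = 0" unfolding 1 by algebra
      finally show ?thesis using nz by simp
    qed
    have bl: "bounded_linear (fst :: real \<times> real \<Rightarrow> real)" "bounded_linear (snd :: real \<times> real \<Rightarrow> real)"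
      by (rule bounded_linear_fst bounded_linear_snd)+
    have P: "real_polynomial_function (\<lambda>p. L1 (fst p) (snd p))"
      unfolding defs
      by (intro real_polynomial_function.intros(1)[OF bl(1)] real_polynomial_function.intros(1)[OF bl(2)]
        real_polynomial_function.intros(2-4) real_polynomial_function_diff real_polynomial_function_power)
    have cont: "continuous_on UNIV (\<lambda>p. (L2 (fst p) (snd p))\<^sup>2 - 4 * K2 (fst p) (snd p))"
      unfolding defs by (intro continuous_intros)
    have "0 \<le> (L2 a1 b1)\<^sup>2 - 4 * K2 a1 b1"
      using polynomial_nonneg_by_density[OF P _ cont, of "(a, b)" "(a1, b1)"] n disc by simp
    moreover have "0 \<le> - ((L2 a1 b1)\<^sup>2 - 4 * K2 a1 b1)"
      using polynomial_nonneg_by_density[OF P _ continuous_on_minus[OF cont], of "(a, b)" "(a1, b1)"] n disc by simp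
    ultimately have d: "(L2 a1 b1)\<^sup>2 = 4 * K2 a1 b1" by simp
    define z where "z = - L2 a1 b1 / (2 * r a1 b1)"
    have K00: "K0 a1 b1 = 0" "K1 a1 b1 = 0" using K[OF ab1] root by auto
    have zr: "z * r a1 b1 = - L2 a1 b1 / 2" using rpos[OF ab1] unfolding z_def by simp
    have "C a1 b1 z = (z * r a1 b1)\<^sup>2 + (z * r a1 b1) * L2 a1 b1 + K2 a1 b1"
      unfolding C_def by (simp add: power_mult_distrib)
    also have "\<dots> = 0" unfolding zr using d by (simp add: power2_eq_square)
    finally have C0: "C a1 b1 z = 0" .
    have B0: "B a1 b1 z = 0" unfolding B_def by (simp add: K00 root)
    have "r a1 b1 * f x s t a1 b1 z = (M x s t a1 b1 z)\<^sup>2" for x s t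
    proof -
      obtain \<sigma> \<rho> where "s = \<sigma> * a1 - \<rho> * b1" "t = \<sigma> * b1 + \<rho> * a1" using decomp[OF ab1] by blast
      then show ?thesis using id[of a1 b1 x \<sigma> \<rho> z] C0 B0 K00 L0[OF ab1] by simp
    qed
    then show False using rank[OF ab1, of z] unfolding M_def r_def n2_def n3_def by blast
  qed
  have K01: "K0 a b = 0" "K1 a b = 0" for a b
  proof -
    have "K0 a b = 0 \<and> K1 a b = 0"
    proof (cases "(a, b) = (0, 0)")
      case True
      then show ?thesis unfolding defs by auto
    next
      case False
      then show ?thesis using K[OF False] L1 by auto
    qed
    then show "K0 a b = 0" "K1 a b = 0" by auto
  qed
  \<comment> \<open>Setting \<open>b = 1\<close> turns the vanishing of the homogeneous forms
    \<open>L0\<close>, \<open>L1\<close> and \<open>K0\<close> into identities in one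
    variable.\<close>
  have "(w2 - 2 * q3) + (2 * v2 + w1 - 2 * (p3 + q2)) * x + (u2 + 2 * v1 - 2 * (p2 + q1)) * x^2
      + (u1 - 2 * p1) * x^3 + 0 * x^4 + 0 * x^5 + 0 * x^6 = 0" for x
    using L0[of x 1] unfolding L0_def defs by (simp add: power2_eq_square power3_eq_cube algebra_simps)
  note c0 = polynomial_coeffs_zero[OF this]
  have "(p3 - v2) + (w2 - u2 - v1 - q3 + p2) * x + (w1 - u1 + v2 - q2 + p1) * x^2
      + (v1 - q1) * x^3 + 0 * x^4 + 0 * x^5 + 0 * x^6 = 0" for x
    using L1[of x 1] unfolding defs by (simp add: power2_eq_square power3_eq_cube algebra_simps)
  note c1 = polynomial_coeffs_zero[OF this]
  have "(b33 - q3\<^sup>2) + (2 * b23 + b32 - 2 * (p3 + q2) * q3) * x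
      + (b33 + (b13 + 2 * b22 + b31) - (2 * (p2 + q1) * q3 + (p3 + q2)\<^sup>2)) * x^2
      + ((2 * b23 + b32) + (b12 + 2 * b21) - (2 * p1 * q3 + 2 * (p2 + q1) * (p3 + q2))) * x^3
      + ((b13 + 2 * b22 + b31) + b11 - (2 * p1 * (p3 + q2) + (p2 + q1)\<^sup>2)) * x^4
      + ((b12 + 2 * b21) - 2 * p1 * (p2 + q1)) * x^5 + (b11 - p1\<^sup>2) * x^6 = 0" for x
    using K01(1)[of x 1] unfolding defs power_one mult_1_right by algebra
  note c2 = polynomial_coeffs_zero[OF this]
  \<comment> \<open>Since \<open>K0 = 0\<close>, \<open>r\<close> divides the square of
    \<open>nt\<close>. Up to sign and a factor two, these are the real and imaginary parts of that
    square at \<open>a = i\<close>, \<open>b = 1\<close>, where \<open>r\<close> vanishes; hence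
    \<open>nt\<close> itself vanishes there.\<close>
  have "(p1 - (p3 + q2))\<^sup>2 - (p2 + q1 - q3)\<^sup>2 = 0" "(p1 - (p3 + q2)) * (p2 + q1 - q3) = 0"
    using c2 by algebra+
  then have "p1 - (p3 + q2) = 0" "p2 + q1 - q3 = 0" by auto
  then have lin: "q2 = p1 - p3" "p2 = q3 - q1" by auto
  \<comment> \<open>By \<open>lin\<close>, \<open>r\<close> divides \<open>nt\<close> and therefore
    \<open>K1\<close>; the quotient at \<open>b = 1\<close> is this quartic.\<close>
  have "(- b23 + q3 * p3) + (b33 - b13 - b22 - (q3 * q1 - p1 * p3)) * x
      + (b32 - b12 + b23 - b21 - (p1 * q1 - q3 * p3)) * x^2
      + (b31 - b11 + b22 - (q3 * q1 - p1 * p3)) * x^3 + (b21 - p1 * q1) * x^4 + 0 * x^5 + 0 * x^6 = 0" for x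
  proof -
    have "(x\<^sup>2 + 1) * ((- b23 + q3 * p3) + (b33 - b13 - b22 - (q3 * q1 - p1 * p3)) * x
      + (b32 - b12 + b23 - b21 - (p1 * q1 - q3 * p3)) * x^2
      + (b31 - b11 + b22 - (q3 * q1 - p1 * p3)) * x^3 + (b21 - p1 * q1) * x^4 + 0 * x^5 + 0 * x^6) = K1 x 1"
      unfolding defs lin power_one mult_1_right by algebra
    moreover have "x\<^sup>2 + 1 \<noteq> 0" using zero_le_power2[of x] by linarith
    ultimately show ?thesis using K01(2)[of x 1] by (metis mult_eq_0_iff)
  qed
  note c3 = polynomial_coeffs_zero[OF this]
  \<comment> \<open>What remains of the coefficient of \<open>a^2 * t^2\<close> after
    \<open>q1^2\<close> and \<open>(p1 - p3)^2\<close>, the contributions of the first two squares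
    in \<open>sq\<close>.\<close>
  define c where "c = b31 - p1\<^sup>2 + 2 * p3 * p1 - q1\<^sup>2 - p3\<^sup>2"
  have eqs: "w2 = 2 * q3" "v2 = p3" "v1 = q1" "u1 = 2 * p1" "w1 = 2 * q2" "u2 = 2 * p2"
    "b33 = q3\<^sup>2" "b11 = p1\<^sup>2" "b21 = p1 * q1" "b23 = q3 * p3" "b31 = c + p1\<^sup>2 - 2 * p3 * p1 + q1\<^sup>2 + p3\<^sup>2"
    using c0 c1 c2 c3 lin unfolding c_def by auto
  have eqs2: "b22 = b11 - b31 + q3 * q1 - p1 * p3" "b13 = b33 - b22 - q3 * q1 + p1 * p3"
      "b12 = 2 * p1 * q3 - 2 * b21" "b32 = 2 * p1 * q3 - 2 * b23"
    using c2 c3 lin by (auto simp: algebra_simps)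
  have sq: "f x s t a b z = (a * x + (z + p1 * a + q3 * b) * s + q1 * (a * t - b * s))\<^sup>2
      + (b * x + (z + p1 * a + q3 * b) * t - p3 * (a * t - b * s))\<^sup>2 + c * (a * t - b * s)\<^sup>2" for x s t a b z
    unfolding f using eqs eqs2 lin by algebra
  \<comment> \<open>At this point the first two squares vanish and \<open>a * t - b * s\<close> is
    1.\<close>
  have "0 \<le> f (- q1) 0 1 1 0 (p3 - p1)" by (rule nn)
  also have "\<dots> = c" unfolding sq by simp
  finally show ?thesis using that sq by blast
qed

section \<open>Reduction of singular forms to the normal form\<close>

lemma orthonormal_pair:
  assumes B: "biform B" "psd B" and rank: "\<And>l. linear l \<Longrightarrow> \<exists>x. B x x y y \<noteq> (l x)\<^sup>2"
  obtains u v where "B u u y y = 1" "B v v y y = 1" "B u v y y = 0"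
proof -
  have "linear (\<lambda>x. 0::real)" by (simp add: linear_iff)
  from rank[OF this] obtain u0 where u0: "B u0 u0 y y \<noteq> 0" by auto
  have scale: "\<exists>u. B u u y y = 1 \<and> (\<forall>x. B x u y y = B x u0 y y / sqrt (B u0 u0 y y))"
    if "B u0 u0 y y \<noteq> 0" for u0
  proof -
    have "B u0 u0 y y > 0" using that B(2) unfolding psd_def by (metis order_le_less)
    then have "B (u0 /\<^sub>R sqrt (B u0 u0 y y)) (u0 /\<^sub>R sqrt (B u0 u0 y y)) y y = 1"
      by (simp add: biform_simps[OF B(1)] field_simps)
    moreover have "B x (u0 /\<^sub>R sqrt (B u0 u0 y y)) y y = B x u0 y y / sqrt (B u0 u0 y y)" for x
      by (simp add: biform_simps[OF B(1)] field_simps)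
    ultimately show ?thesis by blast
  qed
  obtain u where u: "B u u y y = 1" using scale[OF u0] by blast
  \<comment> \<open>The rank hypothesis, applied to pairing with \<open>u\<close>, yields a vector
    whose component orthogonal to \<open>u\<close> has nonzero length.\<close>
  obtain x where x: "B x x y y \<noteq> (B u x y y)\<^sup>2" using rank[OF biform_linear(2)[OF B(1)]] by blast
  let ?v = "x - B u x y y *\<^sub>R u"
  have "B ?v ?v y y = B x x y y - (B u x y y)\<^sup>2"
    using biform_sym(1)[OF B(1), of x u y y] u
    by (simp add: biform_simps[OF B(1)] power2_eq_square algebra_simps)
  then have "B ?v ?v y y \<noteq> 0" using x by simp
  from scale[OF this] obtain v where v: "B v v y y = 1"
    "B u v y y = B u ?v y y / sqrt (B ?v ?v y y)" by blast
  have "B u ?v y y = 0" using u by (simp add: biform_simps[OF B(1)])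
  then show ?thesis using that[OF u v(1)] v(2) by simp
qed

text \<open>The numerical hypotheses say that, in the coordinates of the two frames, the expansion
  at the zero \<open>(x0, y0)\<close> has the shape required by \<open>normal_form\<close>. The
  squares found there are pulled back through the inverse frames.\<close>

lemma sos_if_singular_normal_form:
  fixes B :: "real^3 \<Rightarrow> real^3 \<Rightarrow> real^3 \<Rightarrow> real^3 \<Rightarrow> real"
  assumes B: "biform B" "psd B"
    and sing: "\<And>y. \<exists>x. x \<noteq> 0 \<and> B x x y y = 0"
    and rank: "\<And>y l. y \<noteq> 0 \<Longrightarrow> linear l \<Longrightarrow> \<exists>x. B x x y y \<noteq> (l x)\<^sup>2"
    and V: "bij (frame x0 v2 v3)" and W: "bij (frame w1 w2 y0)"
    and x0: "\<And>y. B x0 x0 y0 y = 0" "B x0 v2 y0 y0 = 0" "B x0 v3 y0 y0 = 0"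
      "B x0 x0 w1 w1 = 1" "B x0 x0 w2 w2 = 1" "B x0 x0 w1 w2 = 0"
    and y0: "B v2 v2 y0 y0 = 1" "B v3 v3 y0 y0 = 1" "B v2 v3 y0 y0 = 0"
    and cross: "2 * B x0 v2 w1 y0 = 1" "2 * B x0 v2 w2 y0 = 0" "2 * B x0 v3 w1 y0 = 0" "2 * B x0 v3 w2 y0 = 1"
  shows "sos B"
proof -
  define f where "f x s t a b z = B (x *\<^sub>R x0 + s *\<^sub>R v2 + t *\<^sub>R v3) (x *\<^sub>R x0 + s *\<^sub>R v2 + t *\<^sub>R v3)
     (a *\<^sub>R w1 + b *\<^sub>R w2 + z *\<^sub>R y0) (a *\<^sub>R w1 + b *\<^sub>R w2 + z *\<^sub>R y0)" for x s t a b z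
  note sx = biform_sym(1)[OF B(1), of v2 x0] biform_sym(1)[OF B(1), of v3 x0] biform_sym(1)[OF B(1), of v3 v2]
  note sy = biform_sym(2)[OF B(1), of _ _ w2 w1] biform_sym(2)[OF B(1), of _ _ y0 w1]
    biform_sym(2)[OF B(1), of _ _ y0 w2]
  have cross': "B x0 v2 w1 y0 = 1/2" "B x0 v2 w2 y0 = 0" "B x0 v3 w1 y0 = 0" "B x0 v3 w2 y0 = 1/2"
    using cross by auto
  have x0': "B x0 x0 w1 y0 = 0" "B x0 x0 w2 y0 = 0" "B x0 x0 y0 y0 = 0"
    using x0(1) biform_sym(2)[OF B(1)] by metis+
  have f: "f x s t a b z = (a\<^sup>2 + b\<^sup>2) * x\<^sup>2
      + 2 * x * (z * (a * s + b * t)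
        + (B x0 v2 w1 w1 * a\<^sup>2 + 2 * B x0 v2 w1 w2 * a * b + B x0 v2 w2 w2 * b\<^sup>2) * s
        + (B x0 v3 w1 w1 * a\<^sup>2 + 2 * B x0 v3 w1 w2 * a * b + B x0 v3 w2 w2 * b\<^sup>2) * t)
      + z\<^sup>2 * (s\<^sup>2 + t\<^sup>2) + z * ((2 * B v2 v2 w1 y0 * a + 2 * B v2 v2 w2 y0 * b) * s\<^sup>2
        + 2 * (2 * B v2 v3 w1 y0 * a + 2 * B v2 v3 w2 y0 * b) * s * t
        + (2 * B v3 v3 w1 y0 * a + 2 * B v3 v3 w2 y0 * b) * t\<^sup>2)
      + (B v2 v2 w1 w1 * a\<^sup>2 + 2 * B v2 v2 w1 w2 * a * b + B v2 v2 w2 w2 * b\<^sup>2) * s\<^sup>2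
      + 2 * (B v2 v3 w1 w1 * a\<^sup>2 + 2 * B v2 v3 w1 w2 * a * b + B v2 v3 w2 w2 * b\<^sup>2) * s * t
      + (B v3 v3 w1 w1 * a\<^sup>2 + 2 * B v3 v3 w1 w2 * a * b + B v3 v3 w2 w2 * b\<^sup>2) * t\<^sup>2" for x s t a b z
    unfolding f_def by (simp add: biform_simps[OF B(1)] sx sy x0 x0' y0 cross' power2_eq_square algebra_simps)
  have nn: "0 \<le> f x s t a b z" for x s t a b z using B(2) unfolding f_def psd_def by blast
  have sing': "\<exists>x s t. (x, s, t) \<noteq> (0, 0, 0) \<and> f x s t a b z = 0" for a b z
  proof -
    obtain X where X: "X \<noteq> 0" "B X X (a *\<^sub>R w1 + b *\<^sub>R w2 + z *\<^sub>R y0) (a *\<^sub>R w1 + b *\<^sub>R w2 + z *\<^sub>R y0) = 0"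
      using sing by blast
    obtain \<xi> where "X = frame x0 v2 v3 \<xi>" using V by (meson bij_pointE)
    then have "f (\<xi>$1) (\<xi>$2) (\<xi>$3) a b z = 0" "(\<xi>$1, \<xi>$2, \<xi>$3) \<noteq> (0,0,0)"
      using X unfolding f_def frame_def by auto
    then show ?thesis by blast
  qed
  let ?g = "\<lambda>x s t a b z. (a\<^sup>2 + b\<^sup>2) * x + z * (a * s + b * t)
        + (B x0 v2 w1 w1 * a\<^sup>2 + 2 * B x0 v2 w1 w2 * a * b + B x0 v2 w2 w2 * b\<^sup>2) * s
        + (B x0 v3 w1 w1 * a\<^sup>2 + 2 * B x0 v3 w1 w2 * a * b + B x0 v3 w2 w2 * b\<^sup>2) * t"
  have rank': "\<exists>x s t. (a\<^sup>2 + b\<^sup>2) * f x s t a b z \<noteq> (?g x s t a b z)\<^sup>2"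
    if ab: "(a, b) \<noteq> (0, 0)" for a b z
  proof (rule ccontr)
    assume "\<not> ?thesis"
    then have eq: "(a\<^sup>2 + b\<^sup>2) * f x s t a b z = (?g x s t a b z)\<^sup>2" for x s t by blast
    have r: "a\<^sup>2 + b\<^sup>2 > 0" using ab by (auto simp: sum_power2_gt_zero_iff)
    let ?Y = "frame w1 w2 y0 (vector [a, b, z])"
    \<comment> \<open>Square root of the assumed identity in frame coordinates; it would exhibit the
      form at the nonzero vector \<open>?Y\<close> as the square of a linear functional.\<close>
    define l where "l X = (let \<xi> = inv (frame x0 v2 v3) X in ?g (\<xi>$1) (\<xi>$2) (\<xi>$3) a b z / sqrt (a\<^sup>2 + b\<^sup>2))" for X
    have li: "linear (inv (frame x0 v2 v3))"
      using inj_linear_imp_inv_linear[OF linear_frame] V by (simp add: bij_def)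
    have "linear l" unfolding l_def Let_def linear_iff
      by (simp add: linear_add[OF li] linear_scale[OF li] algebra_simps add_divide_distrib)
    moreover have "?Y \<noteq> 0"
    proof
      assume "?Y = 0"
      then have "?Y = frame w1 w2 y0 0" by (simp add: linear_0[OF linear_frame])
      then have "vector [a, b, z] = (0 :: real^3)" using W by (simp add: bij_def inj_eq)
      then show False using ab by (simp add: vec_eq_iff forall_3)
    qed
    moreover have "B X X ?Y ?Y = (l X)\<^sup>2" for X
    proof -
      let ?\<xi> = "inv (frame x0 v2 v3) X"
      have X: "frame x0 v2 v3 ?\<xi> = X" using V by (simp add: bij_def surj_f_inv_f)
      have "B X X ?Y ?Y = f (?\<xi>$1) (?\<xi>$2) (?\<xi>$3) a b z"
        by (subst (1 2) X[symmetric]) (simp add: f_def frame_def)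
      also have "\<dots> = (?g (?\<xi>$1) (?\<xi>$2) (?\<xi>$3) a b z)\<^sup>2 / (a\<^sup>2 + b\<^sup>2)" 
        unfolding eq[symmetric] using r by (subst nonzero_mult_div_cancel_left) auto
      finally show ?thesis using r unfolding l_def Let_def power_divide by simp
    qed
    ultimately show False using rank by blast
  qed
  obtain c0 c1 k1 k2 c where c: "0 \<le> c" and
    F: "\<And>x s t a b z. f x s t a b z = (a * x + (z + c0 * a + c1 * b) * s + k1 * (a * t - b * s))\<^sup>2
      + (b * x + (z + c0 * a + c1 * b) * t - k2 * (a * t - b * s))\<^sup>2 + c * (a * t - b * s)\<^sup>2"
    by (rule normal_form[OF f nn sing' rank'], assumption) (rule that)
  let ?V = "inv (frame x0 v2 v3)" and ?W = "inv (frame w1 w2 y0)"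
  have li: "linear ?V" "linear ?W"
      using inj_linear_imp_inv_linear[OF linear_frame] V W by (simp_all add: bij_def)
  let ?pull = "\<lambda>h. \<lambda>X Y. h (?V X $ 1) (?V X $ 2) (?V X $ 3) (?W Y $ 1) (?W Y $ 2) (?W Y $ 3)"
  let ?g1 = "\<lambda>x s t a b z. a * x + (z + c0 * a + c1 * b) * s + k1 * (a * t - b * s)"
  let ?g2 = "\<lambda>x s t a b z. b * x + (z + c0 * a + c1 * b) * t - k2 * (a * t - b * s)"
  let ?g3 = "\<lambda>x s t a b z. sqrt c * (a * t - b * s)"
  have "bilinear (?pull ?g1)" "bilinear (?pull ?g2)" "bilinear (?pull ?g3)"
    unfolding bilinear_def linear_iff
    by (simp_all add: linear_add[OF li(1)] linear_scale[OF li(1)] linear_add[OF li(2)] linear_scale[OF li(2)] algebra_simps)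
  then have "\<forall>g\<in>set [?pull ?g1, ?pull ?g2, ?pull ?g3]. bilinear g" by simp
  moreover have "B X X Y Y = (\<Sum>g\<leftarrow>[?pull ?g1, ?pull ?g2, ?pull ?g3]. (g X Y)\<^sup>2)" for X Y
  proof -
    have X: "frame x0 v2 v3 (?V X) = X" "frame w1 w2 y0 (?W Y) = Y"
      using V W by (simp_all add: bij_def surj_f_inv_f)
    have "B X X Y Y = ?pull f X Y"
      by (subst (1 2) X(1)[symmetric], subst (1 2) X(2)[symmetric]) (simp add: f_def frame_def)
    also have "\<dots> = (\<Sum>g\<leftarrow>[?pull ?g1, ?pull ?g2, ?pull ?g3]. (g X Y)\<^sup>2)"
      unfolding F using c by (simp add: power_mult_distrib)
    finally show ?thesis .
  qed
  ultimately show ?thesis unfolding sos_def by blast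
qed

text \<open>Rank at most one anywhere already gives a sum of squares, so all ranks may be taken to
  be at least two. At a zero \<open>(x0, y0)\<close> this provides orthonormal pairs in both
  variables, and singularity makes the coupling \<open>m\<close> between them an isometry.\<close>

lemma sos_if_singular:
  fixes B :: "real^3 \<Rightarrow> real^3 \<Rightarrow> real^3 \<Rightarrow> real^3 \<Rightarrow> real"
  assumes B: "biform B" "psd B" and sing: "\<And>y. \<exists>x. x \<noteq> 0 \<and> B x x y y = 0"
  shows "sos B"
proof (rule ccontr)
  assume n: "\<not> sos B"
  note S = biform_swap[OF B(1)] psd_swap[OF B(2)]
  have rankx: "\<exists>y. B x x y y \<noteq> (l y)\<^sup>2" if "x \<noteq> 0" "linear l" for x l
    using sos_if_rank_one_left[OF B that] n by blast
  have ranky: "\<exists>x. B x x y y \<noteq> (l x)\<^sup>2" if "y \<noteq> 0" "linear l" for y l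
    using sos_if_rank_one_right[OF B that] n by blast
  define y0 :: "real^3" where "y0 = axis 1 1"
  have y0: "y0 \<noteq> 0" unfolding y0_def by simp
  obtain x0 where x0: "x0 \<noteq> 0" "B x0 x0 y0 y0 = 0" using sing by blast
  have kx: "B x0 x y0 y0 = 0" "B x x0 y0 y0 = 0" for x
    using psd_kernel_left[OF B x0(2)] biform_sym(1)[OF B(1)] by metis+
  have ky: "B x0 x0 y0 y = 0" "B x0 x0 y y0 = 0" for y
    using psd_kernel_right[OF B x0(2)] biform_sym(2)[OF B(1)] by metis+
  obtain v2 v3 where v: "B v2 v2 y0 y0 = 1" "B v3 v3 y0 y0 = 1" "B v2 v3 y0 y0 = 0"
    using orthonormal_pair[OF B ranky[OF y0]] by metis
  have "\<exists>y. swap_form B y y x0 x0 \<noteq> (l y)\<^sup>2" if "linear l" for l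
    using rankx[OF x0(1) that] unfolding swap_form_def .
  from orthonormal_pair[OF S this] obtain w1 w2 where
    "swap_form B w1 w1 x0 x0 = 1" "swap_form B w2 w2 x0 x0 = 1" "swap_form B w1 w2 x0 x0 = 0" by blast
  then have w: "B x0 x0 w1 w1 = 1" "B x0 x0 w2 w2 = 1" "B x0 x0 w1 w2 = 0" unfolding swap_form_def by auto
  have v': "B v3 v2 y0 y0 = 0" and w': "B x0 x0 w2 w1 = 0"
    using v(3) w(3) biform_sym[OF B(1)] by metis+
  have frameV: "bij (frame x0 v v')" if "B v v y0 y0 = 1" "B v' v' y0 y0 = 1" "B v v' y0 y0 = 0" for v v'
  proof (rule frame_bij)
    fix a b c assume h: "a *\<^sub>R x0 + b *\<^sub>R v + c *\<^sub>R v' = 0"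
    have "B v (a *\<^sub>R x0 + b *\<^sub>R v + c *\<^sub>R v') y0 y0 = 0" "B v' (a *\<^sub>R x0 + b *\<^sub>R v + c *\<^sub>R v') y0 y0 = 0"
      unfolding h by (rule biform_zero[OF B(1)])+
    then have "b = 0 \<and> c = 0"
      using that biform_sym(1)[OF B(1), of v' v y0 y0] by (simp add: biform_simps[OF B(1)] kx)
    then show "a = 0 \<and> b = 0 \<and> c = 0" using h x0(1) by simp
  qed
  have frameW: "bij (frame w1 w2 y0)"
  proof (rule frame_bij)
    fix a b c assume h: "a *\<^sub>R w1 + b *\<^sub>R w2 + c *\<^sub>R y0 = 0"
    have "B x0 x0 w1 (a *\<^sub>R w1 + b *\<^sub>R w2 + c *\<^sub>R y0) = 0" "B x0 x0 w2 (a *\<^sub>R w1 + b *\<^sub>R w2 + c *\<^sub>R y0) = 0"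
      unfolding h by (rule biform_zero[OF B(1)])+
    then have "a = 0 \<and> b = 0" using w w' by (simp add: biform_simps[OF B(1)] ky)
    then show "a = 0 \<and> b = 0 \<and> c = 0" using h y0 by simp
  qed
  \<comment> \<open>\<open>2 * m v w\<close> is the coefficient of \<open>x * z\<close> when
    \<open>x0\<close> scaled by \<open>x\<close> is added to \<open>v\<close> and \<open>y0\<close>
    scaled by \<open>z\<close> to \<open>w\<close>.\<close>
  define m where "m v w = 2 * B x0 v w y0" for v w
  have iso: "(a * m v2 w1 + b * m v2 w2)\<^sup>2 + (a * m v3 w1 + b * m v3 w2)\<^sup>2 = a\<^sup>2 + b\<^sup>2"
    if ab: "(a, b) \<noteq> (0, 0)" for a b
  proof -
    let ?w = "a *\<^sub>R w1 + b *\<^sub>R w2"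
    let ?f = "\<lambda>x s t z. B (x *\<^sub>R x0 + s *\<^sub>R v2 + t *\<^sub>R v3) (x *\<^sub>R x0 + s *\<^sub>R v2 + t *\<^sub>R v3) (?w + z *\<^sub>R y0) (?w + z *\<^sub>R y0)"
    note sx = biform_sym(1)[OF B(1), of v2 x0] biform_sym(1)[OF B(1), of v3 x0] biform_sym(1)[OF B(1), of v3 v2]
    show ?thesis
    proof (rule singular_pencil_isometry[of _ ?f])
      show "a\<^sup>2 + b\<^sup>2 > 0" using ab by (auto simp: sum_power2_gt_zero_iff)
      have 1: "B x0 x0 ?w ?w = a\<^sup>2 + b\<^sup>2" using w w' by (simp add: biform_simps[OF B(1)] power2_eq_square)
      have 2: "m v2 ?w = a * m v2 w1 + b * m v2 w2" "m v3 ?w = a * m v3 w1 + b * m v3 w2"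
        unfolding m_def by (simp_all add: biform_simps[OF B(1)])
      have gen: "B (x *\<^sub>R x0 + s *\<^sub>R v2 + t *\<^sub>R v3) (x *\<^sub>R x0 + s *\<^sub>R v2 + t *\<^sub>R v3) (w + z *\<^sub>R y0) (w + z *\<^sub>R y0)
        = B x0 x0 w w * x\<^sup>2 + 2 * x * (z * (m v2 w * s + m v3 w * t) + B x0 v2 w w * s + B x0 v3 w w * t)
        + z\<^sup>2 * (s\<^sup>2 + t\<^sup>2) + z * (2 * B v2 v2 w y0 * s\<^sup>2 + 2 * (2 * B v2 v3 w y0) * s * t + 2 * B v3 v3 w y0 * t\<^sup>2)
        + B v2 v2 w w * s\<^sup>2 + 2 * B v2 v3 w w * s * t + B v3 v3 w w * t\<^sup>2" for x s t z w
        using biform_sym(2)[OF B(1), of _ _ y0 w]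
        by (simp add: biform_simps[OF B(1)] sx kx ky v m_def power2_eq_square algebra_simps)
      show "?f x s t z = (a\<^sup>2 + b\<^sup>2) * x\<^sup>2 + 2 * x * (z * ((a * m v2 w1 + b * m v2 w2) * s + (a * m v3 w1 + b * m v3 w2) * t)
         + B x0 v2 ?w ?w * s + B x0 v3 ?w ?w * t)
        + z\<^sup>2 * (s\<^sup>2 + t\<^sup>2) + z * (2 * B v2 v2 ?w y0 * s\<^sup>2 + 2 * (2 * B v2 v3 ?w y0) * s * t + 2 * B v3 v3 ?w y0 * t\<^sup>2)
        + B v2 v2 ?w ?w * s\<^sup>2 + 2 * B v2 v3 ?w ?w * s * t + B v3 v3 ?w ?w * t\<^sup>2" for x s t z
        unfolding 1[symmetric] 2[symmetric] by (rule gen)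
      show "0 \<le> ?f x s t z" for x s t z using B(2) unfolding psd_def by blast
      show "\<exists>x s t. (x, s, t) \<noteq> (0, 0, 0) \<and> ?f x s t z = 0" for z
      proof -
        obtain X where X: "X \<noteq> 0" "B X X (?w + z *\<^sub>R y0) (?w + z *\<^sub>R y0) = 0" using sing by blast
        obtain \<xi> where "X = frame x0 v2 v3 \<xi>" using frameV[OF v] by (meson bij_pointE)
        then have "?f (\<xi>$1) (\<xi>$2) (\<xi>$3) z = 0" "(\<xi>$1, \<xi>$2, \<xi>$3) \<noteq> (0,0,0)"
          using X unfolding frame_def by auto
        then show ?thesis by blast
      qed
    qed
  qed
  \<comment> \<open>The third instance polarises the norm identity, which gives orthogonality of the
    columns of \<open>m\<close>.\<close>
  have M: "(m v2 w1)\<^sup>2 + (m v3 w1)\<^sup>2 = 1" "(m v2 w2)\<^sup>2 + (m v3 w2)\<^sup>2 = 1"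
    "m v2 w1 * m v2 w2 + m v3 w1 * m v3 w2 = 0"
    using iso[of 1 0] iso[of 0 1] iso[of 1 1] by (auto simp: power2_eq_square algebra_simps)
  \<comment> \<open>rotating \<open>v2\<close>, \<open>v3\<close> makes the isometry \<open>m\<close> the identity\<close>
  define v2' v3' where "v2' = m v2 w1 *\<^sub>R v2 + m v3 w1 *\<^sub>R v3" and "v3' = m v2 w2 *\<^sub>R v2 + m v3 w2 *\<^sub>R v3"
  have V: "B v2' v2' y0 y0 = 1" "B v3' v3' y0 y0 = 1" "B v2' v3' y0 y0 = 0"
    unfolding v2'_def v3'_def
    using M by (simp_all add: biform_simps[OF B(1)] v v' power2_eq_square mult.commute)
  have m': "m v2' w = m v2 w1 * m v2 w + m v3 w1 * m v3 w" "m v3' w = m v2 w2 * m v2 w + m v3 w2 * m v3 w" for w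
    unfolding v2'_def v3'_def by (simp_all add: m_def biform_simps[OF B(1)] algebra_simps)
  have "m v2' w1 = 1" "m v2' w2 = 0" "m v3' w1 = 0" "m v3' w2 = 1"
    unfolding m' using M by (simp_all add: power2_eq_square mult.commute)
  then have "sos B"
    using sos_if_singular_normal_form[OF B sing ranky frameV[OF V] frameW ky(1) kx(1) kx(1) w V]
    unfolding m_def by blast
  with n show False ..
qed

section \<open>Homogeneous polynomials and three-dimensional determinants\<close>

lemma homogeneous_add:
  assumes "homogeneous_polynomial d P" "homogeneous_polynomial d Q"
  shows "homogeneous_polynomial d (\<lambda>y. P y + Q y)"
proof -
  obtain c where c: "\<And>y. P y = (\<Sum>\<alpha> | (\<Sum>i\<in>UNIV. \<alpha> i) = d. c \<alpha> * (\<Prod>i\<in>UNIV. y$i ^ \<alpha> i))"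
    using assms(1) unfolding homogeneous_polynomial_def by blast
  obtain e where e: "\<And>y. Q y = (\<Sum>\<alpha> | (\<Sum>i\<in>UNIV. \<alpha> i) = d. e \<alpha> * (\<Prod>i\<in>UNIV. y$i ^ \<alpha> i))"
    using assms(2) unfolding homogeneous_polynomial_def by blast
  show ?thesis unfolding homogeneous_polynomial_def c e
    by (intro exI[of _ "\<lambda>\<alpha>. c \<alpha> + e \<alpha>"]) (simp add: sum.distrib distrib_right)
qed

lemma homogeneous_monomial:
  assumes "(\<Sum>i\<in>UNIV. \<alpha> i) = d"
  shows "homogeneous_polynomial d (\<lambda>y. c * (\<Prod>i\<in>UNIV. y$i ^ \<alpha> i))"
  unfolding homogeneous_polynomial_def
  using assms
  by (intro exI[of _ "\<lambda>\<beta>. if \<beta> = \<alpha> then c else 0"])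
    (simp add: if_distrib[of "\<lambda>x. x * _"] finite_multi_indices sum.delta cong: if_cong)

lemma homogeneous_zero: "homogeneous_polynomial d (\<lambda>y. 0)"
  unfolding homogeneous_polynomial_def by (intro exI[of _ "\<lambda>_. 0"]) simp

lemma homogeneous_sum:
  assumes "\<And>a. a \<in> A \<Longrightarrow> homogeneous_polynomial d (P a)"
  shows "homogeneous_polynomial d (\<lambda>y. \<Sum>a\<in>A. P a y)"
  using assms by (induction A rule: infinite_finite_induct) (auto intro: homogeneous_zero homogeneous_add)

lemma homogeneous_mult:
  assumes "homogeneous_polynomial d P" "homogeneous_polynomial e Q"
  shows "homogeneous_polynomial (d + e) (\<lambda>y. P y * Q y)"
proof -
  obtain p where p: "\<And>y. P y = (\<Sum>\<alpha> | (\<Sum>i\<in>UNIV. \<alpha> i) = d. p \<alpha> * (\<Prod>i\<in>UNIV. y$i ^ \<alpha> i))"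
    using assms(1) unfolding homogeneous_polynomial_def by blast
  obtain q where q: "\<And>y. Q y = (\<Sum>\<alpha> | (\<Sum>i\<in>UNIV. \<alpha> i) = e. q \<alpha> * (\<Prod>i\<in>UNIV. y$i ^ \<alpha> i))"
    using assms(2) unfolding homogeneous_polynomial_def by blast
  have "P y * Q y = (\<Sum>\<alpha> | (\<Sum>i\<in>UNIV. \<alpha> i) = d. \<Sum>\<beta> | (\<Sum>i\<in>UNIV. \<beta> i) = e.
      (p \<alpha> * q \<beta>) * (\<Prod>i\<in>UNIV. y$i ^ (\<alpha> i + \<beta> i)))" for y
    unfolding p q sum_product by (simp add: power_add prod.distrib mult_ac)
  then show ?thesis
    by (simp only:) (intro homogeneous_sum homogeneous_monomial, simp add: sum.distrib)
qed

lemma homogeneous_coordinate: "homogeneous_polynomial 1 (\<lambda>y. y$i)"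
proof -
  have "y$i = 1 * (\<Prod>j\<in>UNIV. y$j ^ (if j = i then 1 else 0))" for y :: "real^'a"
    by (simp add: if_distrib[of "\<lambda>n. _ ^ n"] cong: if_cong)
  then show ?thesis by (simp only:) (intro homogeneous_monomial, simp)
qed

lemma homogeneous_scale: "homogeneous_polynomial d P \<Longrightarrow> homogeneous_polynomial d (\<lambda>y. c * P y)"
  using homogeneous_mult[of 0 "\<lambda>y. c * (\<Prod>i\<in>UNIV. y$i ^ 0)" d P]
    homogeneous_monomial[of "\<lambda>_. 0" 0 c] by simp

lemma homogeneous_minus: "homogeneous_polynomial d P \<Longrightarrow> homogeneous_polynomial d (\<lambda>y. - P y)"
  using homogeneous_scale[of d P "-1"] by simp

lemma homogeneous_diff:
  "homogeneous_polynomial d P \<Longrightarrow> homogeneous_polynomial d Q \<Longrightarrow> homogeneous_polynomial d (\<lambda>y. P y - Q y)"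
  using homogeneous_add[of d P "\<lambda>y. - Q y"] homogeneous_minus[of d Q] by simp

lemma homogeneous_det:
  fixes A :: "real^'m \<Rightarrow> real^3^3"
  assumes "\<And>i k. homogeneous_polynomial d (\<lambda>y. A y $ i $ k)"
  shows "homogeneous_polynomial (3 * d) (\<lambda>y. det (A y))"
proof -
  have "homogeneous_polynomial (d + d + d) (\<lambda>y. A y $ i $ j * A y $ k $ l * A y $ m $ n)" for i j k l m n
    by (intro homogeneous_mult assms)
  then have "homogeneous_polynomial (3 * d) (\<lambda>y. A y $ i $ j * A y $ k $ l * A y $ m $ n)" for i j k l m n
    by (simp add: numeral_3_eq_3 add.assoc)
  then show ?thesis unfolding det_3 by (intro homogeneous_add homogeneous_diff)
qed

lemma homogeneous_imp_real_polynomial: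
  assumes "homogeneous_polynomial d P"
  shows "real_polynomial_function P"
proof -
  obtain c where c: "P = (\<lambda>y. \<Sum>\<alpha> | (\<Sum>i\<in>UNIV. \<alpha> i) = d. c \<alpha> * (\<Prod>i\<in>UNIV. y$i ^ \<alpha> i))"
    using assms unfolding homogeneous_polynomial_def by blast
  show ?thesis unfolding c
    by (intro real_polynomial_function_sum real_polynomial_function.intros(2,4) real_polynomial_function_prod
        real_polynomial_function_power real_polynomial_function.intros(1) bounded_linear_vec_nth finite_multi_indices) auto
qed

text \<open>\<open>P\<close> and \<open>D - P\<close> are nonnegative with sum \<open>D\<close>,
  hence linearly dependent. Equal coefficients in the dependence are impossible because
  \<open>D\<close> is not the zero polynomial, so it can be solved for \<open>P\<close>.\<close>

lemma extremal_summand: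
  assumes "extremal_polynomial n D" "homogeneous_polynomial (2 * n) P"
    "\<And>y. 0 \<le> P y" "\<And>y. P y \<le> D y"
  obtains c where "\<And>y. P y = c * D y"
proof -
  have D: "homogeneous_polynomial (2 * n) D" "\<exists>y. D y \<noteq> 0"
    using assms(1) unfolding extremal_polynomial_def by blast+
  have "homogeneous_polynomial (2 * n) (\<lambda>y. D y - P y)" by (rule homogeneous_diff[OF D(1) assms(2)])
  moreover have "\<forall>y. 0 \<le> D y - P y" "\<forall>y. D y = P y + (D y - P y)" using assms(4) by auto
  ultimately have "\<not> (\<forall>a b :: real. (\<forall>y. a * P y + b * (D y - P y) = 0) \<longrightarrow> a = 0 \<and> b = 0)"
    using assms unfolding extremal_polynomial_def by blast
  then obtain a b :: real where ab: "\<And>y. a * P y + b * (D y - P y) = 0" "a \<noteq> 0 \<or> b \<noteq> 0" by blast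
  have 1: "(a - b) * P y = - b * D y" for y using ab(1)[of y] by (simp add: algebra_simps)
  have "a \<noteq> b" using 1 D(2) ab(2) by auto
  then have "P y = (- b / (a - b)) * D y" for y using 1[of y] by (simp add: field_simps)
  then show ?thesis using that by blast
qed

section \<open>Cofactors and mixed determinants\<close>

lemma cofactor_matrix_3:
  "cofactor_matrix A $ 1 $ 1 = A$2$2 * A$3$3 - A$2$3 * A$3$2" "cofactor_matrix A $ 1 $ 2 = A$2$3 * A$3$1 - A$2$1 * A$3$3"
  "cofactor_matrix A $ 1 $ 3 = A$2$1 * A$3$2 - A$2$2 * A$3$1" "cofactor_matrix A $ 2 $ 1 = A$3$2 * A$1$3 - A$3$3 * A$1$2"
  "cofactor_matrix A $ 2 $ 2 = A$3$3 * A$1$1 - A$3$1 * A$1$3" "cofactor_matrix A $ 2 $ 3 = A$3$1 * A$1$2 - A$3$2 * A$1$1"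
  "cofactor_matrix A $ 3 $ 1 = A$1$2 * A$2$3 - A$1$3 * A$2$2" "cofactor_matrix A $ 3 $ 2 = A$1$3 * A$2$1 - A$1$1 * A$2$3"
  "cofactor_matrix A $ 3 $ 3 = A$1$1 * A$2$2 - A$1$2 * A$2$1"
proof -
  have [simp]: "(4::3) = 1" "(5::3) = 2" by simp_all
  show "cofactor_matrix A $ 1 $ 1 = A$2$2 * A$3$3 - A$2$3 * A$3$2" "cofactor_matrix A $ 1 $ 2 = A$2$3 * A$3$1 - A$2$1 * A$3$3"
    "cofactor_matrix A $ 1 $ 3 = A$2$1 * A$3$2 - A$2$2 * A$3$1" "cofactor_matrix A $ 2 $ 1 = A$3$2 * A$1$3 - A$3$3 * A$1$2"
    "cofactor_matrix A $ 2 $ 2 = A$3$3 * A$1$1 - A$3$1 * A$1$3" "cofactor_matrix A $ 2 $ 3 = A$3$1 * A$1$2 - A$3$2 * A$1$1"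
    "cofactor_matrix A $ 3 $ 1 = A$1$2 * A$2$3 - A$1$3 * A$2$2" "cofactor_matrix A $ 3 $ 2 = A$1$3 * A$2$1 - A$1$1 * A$2$3"
    "cofactor_matrix A $ 3 $ 3 = A$1$1 * A$2$2 - A$1$2 * A$2$1"
    by (simp_all add: cofactor_matrix_def)
qed

text \<open>The coefficient of \<open>s^2 * t\<close> in the determinant of the pencil
  \<open>s A + t B\<close>, as \<open>det_pencil\<close> confirms.\<close>

definition mixed_det :: "real^3^3 \<Rightarrow> real^3^3 \<Rightarrow> real" where
  "mixed_det A B = cofactor_matrix A \<bullet> B"

lemma mixed_det_3:
  "mixed_det A B = (A$2$2 * A$3$3 - A$2$3 * A$3$2) * B$1$1 + (A$2$3 * A$3$1 - A$2$1 * A$3$3) * B$1$2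
    + (A$2$1 * A$3$2 - A$2$2 * A$3$1) * B$1$3 + (A$3$2 * A$1$3 - A$3$3 * A$1$2) * B$2$1
    + (A$3$3 * A$1$1 - A$3$1 * A$1$3) * B$2$2 + (A$3$1 * A$1$2 - A$3$2 * A$1$1) * B$2$3
    + (A$1$2 * A$2$3 - A$1$3 * A$2$2) * B$3$1 + (A$1$3 * A$2$1 - A$1$1 * A$2$3) * B$3$2
    + (A$1$1 * A$2$2 - A$1$2 * A$2$1) * B$3$3"
  unfolding mixed_det_def inner_vec_def sum_3 cofactor_matrix_3 by simp

lemma det_pencil:
  "det (s *\<^sub>R A + t *\<^sub>R B) = s ^ 3 * det A + s\<^sup>2 * t * mixed_det A B + s * t\<^sup>2 * mixed_det B A + t ^ 3 * det B"
  unfolding mixed_det_3 det_3 by (simp, algebra)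

lemma homogeneous_mixed_det:
  fixes A B :: "real^'m \<Rightarrow> real^3^3"
  assumes "\<And>i k. homogeneous_polynomial d (\<lambda>y. A y $ i $ k)" "\<And>i k. homogeneous_polynomial d (\<lambda>y. B y $ i $ k)"
  shows "homogeneous_polynomial (3 * d) (\<lambda>y. mixed_det (A y) (B y))"
proof -
  have "homogeneous_polynomial (d + d + d) (\<lambda>y. mixed_det (A y) (B y))"
    unfolding mixed_det_3 by (intro homogeneous_add homogeneous_mult homogeneous_diff assms)
  then show ?thesis by (simp add: numeral_3_eq_3 add.assoc)
qed

lemma mixed_det_add: "mixed_det A (B + C) = mixed_det A B + mixed_det A C"
  unfolding mixed_det_def by (rule inner_add_right)

lemma mixed_det_zero: "mixed_det A 0 = 0" "mixed_det 0 (v \<otimes>\<^sub>o v) = 0"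
  by (simp_all add: mixed_det_3)

text \<open>The cofactor matrix of \<open>v \<otimes>\<^sub>o v\<close> vanishes, so the expansion
  stops after the linear term.\<close>

lemma det_add_outer: "det (A + v \<otimes>\<^sub>o v) = det A + mixed_det A (v \<otimes>\<^sub>o v)"
  unfolding mixed_det_3 det_3 outer_product_def by (simp, algebra)

text \<open>The cofactor matrix of \<open>u \<otimes>\<^sub>o u\<close> vanishes, so only a cross
  term is gained, and this is the form of \<open>A\<close> at the cross product.\<close>

lemma mixed_det_add_outer:
  "mixed_det (A + u \<otimes>\<^sub>o u) (v \<otimes>\<^sub>o v) = mixed_det A (v \<otimes>\<^sub>o v) + cross3 u v \<bullet> (A *v cross3 u v)"
  unfolding mixed_det_3 outer_product_def cross3_def inner_vec_def matrix_vector_mult_def sum_3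
  by (simp, algebra)

section \<open>Gram matrices and determinants as sums of squares\<close>

definition gram :: "(real^3) list \<Rightarrow> real^3^3" where
  "gram us = (\<Sum>u\<leftarrow>us. u \<otimes>\<^sub>o u)"

lemma gram_simps [simp]: "gram [] = 0" "gram (u # us) = u \<otimes>\<^sub>o u + gram us"
  by (simp_all add: gram_def)

lemma outer_form: "x \<bullet> ((u \<otimes>\<^sub>o u) *v x) = (u \<bullet> x)\<^sup>2"
  by (simp add: outer_product_def inner_vec_def matrix_vector_mult_def sum_3 power2_eq_square algebra_simps)

lemma gram_form: "x \<bullet> (gram us *v x) = (\<Sum>u\<leftarrow>us. (u \<bullet> x)\<^sup>2)"
  by (induction us) (simp_all add: outer_form matrix_vector_mult_add_rdistrib inner_add_right)

lemma gram_sym: "gram us $ i $ k = gram us $ k $ i"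
  by (induction us) (simp_all add: outer_product_def mult.commute)

text \<open>Each added vector \<open>u\<close> contributes the Gram form at
  \<open>cross3 u v\<close>, which is a sum of squares.\<close>

lemma mixed_det_gram_outer_nonneg: "0 \<le> mixed_det (gram us) (v \<otimes>\<^sub>o v)"
proof (induction us)
  case (Cons u us)
  have "0 \<le> cross3 u v \<bullet> (gram us *v cross3 u v)"
    unfolding gram_form by (intro sum_list_nonneg) auto
  with Cons show ?case
    using mixed_det_add_outer[of "gram us" u v] by (simp add: add.commute)
qed (simp add: mixed_det_zero)

lemma mixed_det_gram_nonneg: "0 \<le> mixed_det (gram us) (gram vs)"
  by (induction vs) (simp_all add: mixed_det_zero mixed_det_add mixed_det_gram_outer_nonneg)

lemma det_gram_nonneg: "0 \<le> det (gram us)"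
proof (induction us)
  case (Cons u us)
  then show ?case
    using det_add_outer[of "gram us" u] mixed_det_gram_outer_nonneg[of us u] by (simp add: add.commute)
qed (simp add: det_3)

lemma sym_matrix_eqI:
  fixes A B :: "real^'n^'n"
  assumes "\<And>i k. A $ i $ k = A $ k $ i" "\<And>i k. B $ i $ k = B $ k $ i"
    and eq: "\<And>x. x \<bullet> (A *v x) = x \<bullet> (B *v x)"
  shows "A = B"
proof -
  have ax: "axis i 1 \<bullet> (M *v axis k 1) = M $ i $ k" for M :: "real^'n^'n" and i k
    by (simp add: inner_axis' matrix_vector_mult_basis column_def)
  have pol: "(axis i 1 + axis k 1) \<bullet> (M *v (axis i 1 + axis k 1)) = M$i$i + M$k$k + M$i$k + M$k$i"
    for M :: "real^'n^'n" and i k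
    by (simp add: matrix_vector_right_distrib inner_add_left inner_add_right ax)
  have "A $ i $ k = B $ i $ k" for i k
    using eq[of "axis i 1 + axis k 1"] eq[of "axis i 1"] eq[of "axis k 1"] assms(1,2)[of i k]
    unfolding pol ax by simp
  then show ?thesis by (simp add: vec_eq_iff)
qed

text \<open>Multiplied by the square of the first coordinate of an auxiliary \<open>z\<close>, the
  form becomes biquadratic and ignores the second coordinate of \<open>z\<close>. The result for
  forms with a kernel makes it a sum of squares, and evaluation at the first basis vector yields the
  Gram vectors.\<close>

lemma psd_matrix_is_gram:
  fixes A :: "real^3^3"
  assumes sym: "\<And>i k. A $ i $ k = A $ k $ i" and nn: "\<And>x. 0 \<le> x \<bullet> (A *v x)"
  obtains us where "A = gram us"
proof -
  define B where "B = (\<lambda>(x::real^3) x' (z::real^3) (z'::real^3). x \<bullet> (A *v x') * (z$1 * z'$1))"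
  have sym': "x \<bullet> (A *v x') = x' \<bullet> (A *v x)" for x x'
    using sym by (simp add: inner_vec_def matrix_vector_mult_def sum_3 algebra_simps)
  have b: "biform B" unfolding biform_def B_def linear_iff
    using sym' by (auto simp: inner_add_left algebra_simps)
  have p: "psd B" unfolding psd_def B_def using nn by simp
  have "axis 2 1 \<in> ker_left (swap_form B)"
    unfolding ker_left_def swap_form_def B_def by (simp add: axis_def)
  from sos_if_ker_left_nontrivial[OF biform_swap[OF b] psd_swap[OF p] _ this]
  have "sos B" using sos_swap[of "swap_form B"] by simp
  then obtain gs where gs: "\<forall>g\<in>set gs. bilinear g" "\<And>x y. B x x y y = (\<Sum>g\<leftarrow>gs. (g x y)\<^sup>2)"
    unfolding sos_def by blast
  define vec where "vec g = (\<chi> i. g (axis i 1) (axis 1 1))" for g :: "real^3 \<Rightarrow> real^3 \<Rightarrow> real"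
  have vec: "vec g \<bullet> x = g x (axis 1 1)" if "bilinear g" for g x
  proof -
    have "linear (\<lambda>x. g x (axis 1 1))" using that unfolding bilinear_def by blast
    from linear_sum[OF this, of "\<lambda>i. x$i *\<^sub>R axis i 1" UNIV]
    have "g (\<Sum>i\<in>UNIV. x$i *\<^sub>R axis i 1) (axis 1 1) = (\<Sum>i\<in>UNIV. x$i * g (axis i 1) (axis 1 1))"
      using that by (simp add: bilinear_lmul)
    then show ?thesis
      using basis_expansion[of x] by (simp add: vec_def inner_vec_def scalar_mult_eq_scaleR mult.commute)
  qed
  have "x \<bullet> (A *v x) = x \<bullet> (gram (map vec gs) *v x)" for x
  proof -
    have "x \<bullet> (A *v x) = B x x (axis 1 1) (axis 1 1)" unfolding B_def by simp
    also have "\<dots> = (\<Sum>g\<leftarrow>gs. (vec g \<bullet> x)\<^sup>2)"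
      unfolding gs(2) using gs(1) vec by (intro arg_cong[of _ _ sum_list] map_cong) auto
    finally show ?thesis unfolding gram_form by (simp add: comp_def)
  qed
  from sym_matrix_eqI[OF sym gram_sym this] show ?thesis using that by blast
qed

text \<open>Cauchy-Binet, built up by adding one vector at a time: each square is that of a triple
  product of three vectors linear in \<open>y\<close>, hence of a cubic.\<close>

lemma det_gram_squares:
  fixes As :: "(real^3^3) list"
  shows "\<exists>ps. (\<forall>p\<in>set ps. homogeneous_polynomial 3 p) \<and>
    (\<forall>y. det (gram (map (\<lambda>A. A *v y) As)) = (\<Sum>p\<leftarrow>ps. (p y)\<^sup>2))"
proof -
  have lin: "homogeneous_polynomial 1 (\<lambda>y. (A *v y) $ i)" for A :: "real^3^3" and i
    unfolding matrix_vector_mult_def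
    by (simp only: vec_lambda_beta) (intro homogeneous_sum homogeneous_scale homogeneous_coordinate)
  have triple: "homogeneous_polynomial 3 (\<lambda>y. (A *v y) \<bullet> cross3 (A' *v y) (A'' *v y))"
    for A A' A'' :: "real^3^3"
  proof -
    have "homogeneous_polynomial (1 + (1 + 1)) (\<lambda>y. (A *v y) $ i * ((A' *v y) $ j * (A'' *v y) $ k))" for i j k
      by (intro homogeneous_mult lin)
    then have h: "homogeneous_polynomial 3 (\<lambda>y. (A *v y) $ i * ((A' *v y) $ j * (A'' *v y) $ k))" for i j k
      by (simp add: numeral_3_eq_3)
    show ?thesis unfolding cross3_def inner_vec_def sum_3
      by (simp add: right_diff_distrib) (intro homogeneous_add homogeneous_diff h)
  qed
  have mix: "\<exists>ps. (\<forall>p\<in>set ps. homogeneous_polynomial 3 p) \<and>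
    (\<forall>y. mixed_det (gram (map (\<lambda>A. A *v y) As)) ((M *v y) \<otimes>\<^sub>o (M *v y)) = (\<Sum>p\<leftarrow>ps. (p y)\<^sup>2))"
    for M :: "real^3^3" and As
  proof (induction As)
    case Nil
    show ?case by (intro exI[of _ "[]"]) (simp add: mixed_det_zero)
  next
    case (Cons A As)
    then obtain ps where "\<forall>p\<in>set ps. homogeneous_polynomial 3 p"
      "\<And>y. mixed_det (gram (map (\<lambda>A. A *v y) As)) ((M *v y) \<otimes>\<^sub>o (M *v y)) = (\<Sum>p\<leftarrow>ps. (p y)\<^sup>2)" by blast
    then show ?case
      using triple
      by (intro exI[of _ "ps @ map (\<lambda>N y. (N *v y) \<bullet> cross3 (A *v y) (M *v y)) As"])
        (auto simp: add.commute[of "_ \<otimes>\<^sub>o _"] mixed_det_add_outer gram_form comp_def)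
  qed
  show ?thesis
  proof (induction As)
    case Nil
    show ?case by (intro exI[of _ "[]"]) (simp add: det_3)
  next
    case (Cons A As)
    then obtain ps where "\<forall>p\<in>set ps. homogeneous_polynomial 3 p"
      "\<And>y. det (gram (map (\<lambda>A. A *v y) As)) = (\<Sum>p\<leftarrow>ps. (p y)\<^sup>2)" by blast
    moreover obtain qs where "\<forall>p\<in>set qs. homogeneous_polynomial 3 p"
      "\<And>y. mixed_det (gram (map (\<lambda>A. A *v y) As)) ((A *v y) \<otimes>\<^sub>o (A *v y)) = (\<Sum>p\<leftarrow>qs. (p y)\<^sup>2)" 
      using mix by blast
    ultimately show ?case
      by (intro exI[of _ "ps @ qs"]) (auto simp: add.commute[of "_ \<otimes>\<^sub>o _"] det_add_outer)
  qed
qed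

text \<open>Symmetrising the tensor of the square of \<open>A \<bullet> \<xi>\<close> changes that
  square only by 2x2 minors of \<open>\<xi>\<close>, weighted by the corresponding minors of
  \<open>A\<close>.\<close>

lemma cofactor_identity:
  fixes A \<xi> :: "real^3^3"
  shows "(\<Sum>i\<in>UNIV. \<Sum>j\<in>UNIV. \<Sum>k\<in>UNIV. \<Sum>l\<in>UNIV.
    (A$i$j * A$k$l + A$i$l * A$k$j) * \<xi>$i$j * \<xi>$k$l) = 2 * ((A \<bullet> \<xi>)\<^sup>2 - cofactor_matrix A \<bullet> cofactor_matrix \<xi>)"
  unfolding inner_vec_def sum_3 cofactor_matrix_3 by (simp add: power2_eq_square algebra_simps)

section \<open>Acoustic tensors\<close>

text \<open>Polarisation, first in \<open>x\<close> and then in \<open>y\<close>.\<close>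

lemma biform_eqI:
  assumes A: "biform A" and B: "biform B" and eq: "\<And>x y. A x x y y = B x x y y"
  shows "A x x' y y' = B x x' y y'"
proof -
  have 1: "A x x' y y = B x x' y y" for x x' y
    using eq[of "x + x'" y] eq[of x y] eq[of x' y] biform_sym(1)[OF A, of x' x] biform_sym(1)[OF B, of x' x]
    by (simp add: biform_simps[OF A] biform_simps[OF B])
  show ?thesis
    using 1[of x x' "y + y'"] 1[of x x' y] 1[of x x' y'] biform_sym(2)[OF A, of x x' y' y] biform_sym(2)[OF B, of x x' y' y]
    by (simp add: biform_simps[OF A] biform_simps[OF B])
qed

section \<open>Matrices of forms and comparison of pencils\<close>

lemma det_zero_iff_kernel:
  fixes A :: "real^'n^'n"
  shows "det A = 0 \<longleftrightarrow> (\<exists>x. x \<noteq> 0 \<and> A *v x = 0)"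
  using invertible_det_nz[of A] matrix_left_invertible_ker[of A] unfolding invertible_left_inverse by blast

definition form_matrix :: "(real^'n \<Rightarrow> real^'n \<Rightarrow> 'b \<Rightarrow> 'b \<Rightarrow> real) \<Rightarrow> 'b \<Rightarrow> real^'n^'n" where
  "form_matrix B y = (\<chi> i k. B (axis i 1) (axis k 1) y y)"

lemma form_matrix_sym: "biform B \<Longrightarrow> form_matrix B y $ i $ k = form_matrix B y $ k $ i"
  unfolding form_matrix_def using biform_sym(1)[of B "axis i 1" "axis k 1" y y] by simp

lemma form_matrix_vec:
  assumes "biform B"
  shows "(form_matrix B y *v x) $ i = B (axis i 1) x y y"
  unfolding form_matrix_def matrix_vector_mult_def
  using biform_expand_left[OF assms, of x "axis i 1" y y] biform_sym(1)[OF assms, of _ "axis i 1"]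
  by (simp add: mult.commute)

lemma form_matrix_form:
  assumes "biform B"
  shows "x \<bullet> (form_matrix B y *v x) = B x x y y"
  using biform_expand_left[OF assms, of x x y y]
  by (simp add: inner_vec_def form_matrix_vec[OF assms])

lemma det_form_matrix_zero_iff:
  assumes "biform B" "psd B"
  shows "det (form_matrix B y) = 0 \<longleftrightarrow> (\<exists>x. x \<noteq> 0 \<and> B x x y y = 0)"
proof -
  have "form_matrix B y *v x = 0 \<longleftrightarrow> B x x y y = 0" for x
  proof
    assume "B x x y y = 0"
    then have "B x x' y y = 0" for x' by (rule psd_kernel_left[OF assms])
    then show "form_matrix B y *v x = 0"
      by (simp add: vec_eq_iff form_matrix_vec[OF assms(1)] biform_sym(1)[OF assms(1), of _ x])
  qed (use form_matrix_form[OF assms(1), of x y] in simp)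
  then show ?thesis by (simp add: det_zero_iff_kernel)
qed

lemma form_matrix_gram:
  fixes B :: "real^3 \<Rightarrow> real^3 \<Rightarrow> 'b::real_vector \<Rightarrow> 'b \<Rightarrow> real"
  assumes "biform B" "psd B"
  obtains us where "form_matrix B y = gram us"
proof (rule psd_matrix_is_gram)
  show "form_matrix B y $ i $ k = form_matrix B y $ k $ i" for i k by (rule form_matrix_sym[OF assms(1)])
  show "0 \<le> x \<bullet> (form_matrix B y *v x)" for x
    using assms(2) unfolding form_matrix_form[OF assms(1)] psd_def by blast
qed (rule that)

lemma psd_det_bounds:
  fixes A B :: "real^3 \<Rightarrow> real^3 \<Rightarrow> 'b::real_vector \<Rightarrow> 'b \<Rightarrow> real"
  assumes "biform A" "psd A" "biform B" "psd B"
  shows "0 \<le> det (form_matrix A y)" "0 \<le> mixed_det (form_matrix A y) (form_matrix B y)"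
proof -
  obtain us vs where "form_matrix A y = gram us" "form_matrix B y = gram vs"
    using form_matrix_gram[OF assms(1,2)] form_matrix_gram[OF assms(3,4)] by metis
  then show "0 \<le> det (form_matrix A y)" "0 \<le> mixed_det (form_matrix A y) (form_matrix B y)"
    by (simp_all add: det_gram_nonneg mixed_det_gram_nonneg)
qed

lemma continuous_on_biform_args:
  fixes B :: "real^'m \<Rightarrow> real^'m \<Rightarrow> real^'n \<Rightarrow> real^'n \<Rightarrow> real"
  assumes "biform B"
  shows "continuous_on S (\<lambda>x. B x x y y)" "continuous_on T (\<lambda>y. B x x y y)"
proof -
  have p: "continuous_on S (\<lambda>x. (x, y))" "continuous_on T (\<lambda>y. (x, y))" by (intro continuous_intros)+
  show "continuous_on S (\<lambda>x. B x x y y)" "continuous_on T (\<lambda>y. B x x y y)"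
    using continuous_on_compose2[OF continuous_on_biform[OF assms, of UNIV] p(1)]
      continuous_on_compose2[OF continuous_on_biform[OF assms, of UNIV] p(2)] by simp_all
qed

text \<open>By \<open>det\<close>, wherever the determinant of \<open>T\<close> is nonzero the
  eigenvalues of \<open>S\<close> relative to \<open>T\<close> are roots of the same function
  \<open>p\<close>. They are nonnegative, and \<open>p 0\<close> being nonzero keeps them uniformly
  away from 0, so one \<open>e\<close> serves all such \<open>y\<close>; density covers the
  remaining ones.\<close>

lemma positive_multiple_below:
  fixes S T :: "real^3 \<Rightarrow> real^3 \<Rightarrow> real^'n \<Rightarrow> real^'n \<Rightarrow> real"
  assumes S: "biform S" "psd S" and T: "biform T" "psd T"
    and p: "continuous_on UNIV p" "p 0 \<noteq> 0"
    and det: "\<And>c y. det (form_matrix S y - c *\<^sub>R form_matrix T y) = p c * det (form_matrix T y)"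
    and pol: "real_polynomial_function (\<lambda>y. det (form_matrix T y))" and nz: "det (form_matrix T u) \<noteq> 0"
  obtains e :: real where "e > 0" "\<And>x y. e * T x x y y \<le> S x x y y"
proof -
  have "isCont p 0" using p(1) by (simp add: continuous_on_eq_continuous_at)
  from continuous_at_avoid[OF this p(2)] obtain d where d: "d > 0" "\<And>c. dist 0 c < d \<Longrightarrow> p c \<noteq> 0" by auto
  define e where "e = d / 2"
  have e: "e > 0" "\<And>c. 0 \<le> c \<Longrightarrow> c \<le> e \<Longrightarrow> p c \<noteq> 0" using d unfolding e_def by (auto simp: dist_real_def)
  have gen: "e * T x x y y \<le> S x x y y" if nzy: "det (form_matrix T y) \<noteq> 0" for x y
  proof -
    have Tpos: "T x x y y > 0" if "x \<noteq> 0" for x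
      using T(2) that nzy unfolding det_form_matrix_zero_iff[OF T] psd_def by (metis order_le_less)
    have Tne: "\<forall>x\<in>sphere 0 1. T x x y y \<noteq> 0"
    proof
      fix x :: "real^3" assume "x \<in> sphere 0 1"
      then have "x \<noteq> 0" by auto
      from Tpos[OF this] show "T x x y y \<noteq> 0" by simp
    qed
    have cq: "continuous_on (sphere 0 1) (\<lambda>x. S x x y y / T x x y y)"
      by (intro continuous_on_divide continuous_on_biform_args[OF S(1)] continuous_on_biform_args[OF T(1)] Tne)
    have cs: "compact (sphere (0::real^3) 1)" "sphere (0::real^3) 1 \<noteq> {}" by auto
    \<comment> \<open>A minimiser of the Rayleigh quotient; its value \<open>c\<close> is the
      smallest eigenvalue of \<open>S\<close> relative to \<open>T\<close> at
      \<open>y\<close>.\<close>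
    obtain z where z: "z \<in> sphere 0 1" "\<And>x. x \<in> sphere 0 1 \<Longrightarrow> S z z y y / T z z y y \<le> S x x y y / T x x y y"
      using continuous_attains_inf[OF cs cq] by blast
    have z0: "z \<noteq> 0" using z(1) by auto
    define c where "c = S z z y y / T z z y y"
    have c0: "c \<ge> 0" using S(2) T(2) unfolding c_def psd_def by simp
    have low: "c * T x x y y \<le> S x x y y" for x
    proof (cases "x = 0")
      case True
      then show ?thesis by (simp add: biform_zero[OF S(1)] biform_zero[OF T(1)])
    next
      case False
      have "c \<le> S (x /\<^sub>R norm x) (x /\<^sub>R norm x) y y / T (x /\<^sub>R norm x) (x /\<^sub>R norm x) y y"
        unfolding c_def using False by (intro z(2)) simp
      also have "\<dots> = S x x y y / T x x y y"
        using False by (simp add: biform_simps[OF S(1)] biform_simps[OF T(1)])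
      finally show ?thesis using Tpos[OF False] by (simp add: field_simps)
    qed
    have "c > e"
    proof (rule ccontr)
      assume "\<not> c > e"
      then have pc: "p c \<noteq> 0" using e(2) c0 by simp
      have "(S z z y y - c * T z z y y) = 0" using Tpos[OF z0] unfolding c_def by simp
      \<comment> \<open>\<open>S - c T\<close> is nonnegative at \<open>y\<close> and vanishes at
        \<open>z\<close>, so \<open>z\<close> is a kernel vector and \<open>c\<close> is a root of
        \<open>p\<close>.\<close>
      have kz: "S z x y y - c * T z x y y = 0" for x
      proof -
        have "2 * (S z x y y - c * T z x y y) = 0"
        proof (rule quadratic_nonneg_linear_zero)
          fix t
          have "0 \<le> S (z + t *\<^sub>R x) (z + t *\<^sub>R x) y y - c * T (z + t *\<^sub>R x) (z + t *\<^sub>R x) y y"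
            using low[of "z + t *\<^sub>R x"] by simp
          also have "\<dots> = 2 * (S z x y y - c * T z x y y) * t + (S x x y y - c * T x x y y) * t\<^sup>2"
            using \<open>(S z z y y - c * T z z y y) = 0\<close> biform_sym(1)[OF S(1), of x z] biform_sym(1)[OF T(1), of x z]
            by (simp add: biform_simps[OF S(1)] biform_simps[OF T(1)] power2_eq_square algebra_simps)
          finally show "0 \<le> 2 * (S z x y y - c * T z x y y) * t + (S x x y y - c * T x x y y) * t\<^sup>2" .
        qed
        then show ?thesis by simp
      qed
      have "(form_matrix S y - c *\<^sub>R form_matrix T y) *v z = 0"
        using kz biform_sym(1)[OF S(1), of _ z] biform_sym(1)[OF T(1), of _ z]
        by (simp add: vec_eq_iff matrix_vector_mult_diff_rdistrib scaleR_matrix_vector_assoc[symmetric]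
            form_matrix_vec[OF S(1)] form_matrix_vec[OF T(1)])
      then have "det (form_matrix S y - c *\<^sub>R form_matrix T y) = 0"
        using z0 det_zero_iff_kernel by blast
      then show False using pc nzy unfolding det by simp
    qed
    then have "e * T x x y y \<le> c * T x x y y"
      using T(2) unfolding psd_def by (intro mult_right_mono) auto
    then show ?thesis using low[of x] by linarith
  qed
  have "e * T x x y y \<le> S x x y y" for x y
  proof -
    have cS: "continuous_on UNIV (\<lambda>y. S x x y y - e * T x x y y)"
      by (intro continuous_intros continuous_on_biform_args S T)
    have "0 \<le> S x x y y - e * T x x y y"
      by (rule polynomial_nonneg_by_density[OF pol nz cS]) (simp add: gen)
    then show ?thesis by simp
  qed
  then show ?thesis using that e(1) by blast
qed

section \<open>Biquadratic forms of symmetric tensors\<close>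

definition tensor_form :: "(3 \<Rightarrow> 3 \<Rightarrow> 3 \<Rightarrow> 3 \<Rightarrow> real) \<Rightarrow> real^3 \<Rightarrow> real^3 \<Rightarrow> real^3 \<Rightarrow> real^3 \<Rightarrow> real" where
  "tensor_form C x x' y y' = (\<Sum>i\<in>UNIV. \<Sum>j\<in>UNIV. \<Sum>k\<in>UNIV. \<Sum>l\<in>UNIV. C i j k l * x$i * y$j * x'$k * y'$l)"

lemma sum_reverse:
  "(\<Sum>i\<in>A. \<Sum>j\<in>B. \<Sum>k\<in>D. F i j k) = (\<Sum>k\<in>D. \<Sum>j\<in>B. \<Sum>i\<in>A. F i j k)"
proof -
  have "(\<Sum>i\<in>A. \<Sum>j\<in>B. \<Sum>k\<in>D. F i j k) = (\<Sum>i\<in>A. \<Sum>k\<in>D. \<Sum>j\<in>B. F i j k)"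
    by (rule sum.cong[OF refl]) (rule sum.swap)
  also have "\<dots> = (\<Sum>k\<in>D. \<Sum>i\<in>A. \<Sum>j\<in>B. F i j k)" by (rule sum.swap)
  also have "\<dots> = (\<Sum>k\<in>D. \<Sum>j\<in>B. \<Sum>i\<in>A. F i j k)"
    by (rule sum.cong[OF refl]) (rule sum.swap)
  finally show ?thesis .
qed

lemma biform_tensor_form:
  assumes "tensor_symmetric C"
  shows "biform (tensor_form C)"
proof -
  have "linear (\<lambda>x. tensor_form C x x' y y')" "linear (\<lambda>y. tensor_form C x x' y y')" for x x' y y'
    unfolding tensor_form_def linear_iff
    by (simp_all add: algebra_simps sum.distrib sum_distrib_left)
  moreover have "tensor_form C x x' y y' = tensor_form C x' x y y'" for x x' y y'
  proof -
    have eq: "C i j k l * x$i * y$j * x'$k * y'$l = C k j i l * x'$k * y$j * x$i * y'$l" for i j k l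
      using assms unfolding tensor_symmetric_def by (simp add: mult_ac)
    show ?thesis unfolding tensor_form_def
      by (rule trans[OF sum_reverse], (rule sum.cong[OF refl])+, rule eq)
  qed
  moreover have "tensor_form C x x' y y' = tensor_form C x x' y' y" for x x' y y'
  proof -
    have eq: "C i j k l * x$i * y$j * x'$k * y'$l = C i l k j * x$i * y'$l * x'$k * y$j" for i j k l
      using assms unfolding tensor_symmetric_def by (simp add: mult_ac)
    show ?thesis unfolding tensor_form_def
      by (rule sum.cong[OF refl], rule trans[OF sum_reverse], (rule sum.cong[OF refl])+, rule eq)
  qed
  ultimately show ?thesis unfolding biform_def by blast
qed

lemma quadratic_form_tensor_form: "quadratic_form C (x \<otimes>\<^sub>o y) = tensor_form C x x y y"
  unfolding quadratic_form_def tensor_form_def outer_product_def by (simp add: mult_ac)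

lemma tensor_form_axis:
  "tensor_form C (axis i 1) (axis k 1) y y' = (\<Sum>j\<in>UNIV. \<Sum>l\<in>UNIV. C i j k l * y$j * y'$l)"
  using exhaust_3[of i] exhaust_3[of k] by (auto simp: tensor_form_def sum_3 axis_def)

lemma acoustic_tensor_form_matrix: "acoustic_tensor C y = form_matrix (tensor_form C) y"
  unfolding acoustic_tensor_def form_matrix_def tensor_form_axis ..

text \<open>Recovers the tensor from its form. Both \<open>x\<close> arguments precede the
  \<open>y\<close> arguments, hence the order \<open>i k j l\<close> on the left.\<close>

lemma tensor_form_coeff: "tensor_form C (axis i 1) (axis k 1) (axis j 1) (axis l 1) = C i j k l"
  unfolding tensor_form_axis using exhaust_3[of j] exhaust_3[of l] by (auto simp: sum_3 axis_def)

lemma homogeneous_acoustic_tensor: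
  "homogeneous_polynomial 2 (\<lambda>y. form_matrix (tensor_form C) y $ i $ k)"
proof -
  have "homogeneous_polynomial (1 + 1) (\<lambda>y. \<Sum>j\<in>UNIV. \<Sum>l\<in>UNIV. C i j k l * (y$j * y$l))"
    by (intro homogeneous_sum homogeneous_scale homogeneous_mult homogeneous_coordinate)
  then show ?thesis
    unfolding form_matrix_def by (simp add: tensor_form_axis mult.assoc numeral_2_eq_2)
qed

section \<open>Consequences of being a sum of squares\<close>

lemma bilinear_matrix:
  fixes g :: "real^3 \<Rightarrow> real^3 \<Rightarrow> real"
  assumes "bilinear g"
  shows "g x y = x \<bullet> ((\<chi> i j. g (axis i 1) (axis j 1)) *v y)"
proof -
  have ex: "(\<Sum>i\<in>UNIV. x$i *\<^sub>R axis i 1) = x" for x :: "real^3"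
    using basis_expansion[of x] by (simp add: scalar_mult_eq_scaleR)
  have 1: "g x y = (\<Sum>i\<in>UNIV. x$i * g (axis i 1) y)" for x y
    using linear_sum[of "\<lambda>x. g x y" "\<lambda>i. x$i *\<^sub>R axis i 1" UNIV] assms
    by (simp add: ex bilinear_def bilinear_lmul[OF assms])
  have 2: "g x y = (\<Sum>j\<in>UNIV. y$j * g x (axis j 1))" for x y
    using linear_sum[of "\<lambda>y. g x y" "\<lambda>i. y$i *\<^sub>R axis i 1" UNIV] assms
    by (simp add: ex bilinear_def bilinear_rmul[OF assms])
  have "g x y = (\<Sum>i\<in>UNIV. x$i * (\<Sum>j\<in>UNIV. y$j * g (axis i 1) (axis j 1)))"
    unfolding 1[of x y] by (simp only: 2[of _ y])
  then show ?thesis by (simp add: inner_vec_def matrix_vector_mult_def mult.commute)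
qed

lemma sos_matrices:
  fixes B :: "real^3 \<Rightarrow> real^3 \<Rightarrow> real^3 \<Rightarrow> real^3 \<Rightarrow> real"
  assumes "sos B"
  obtains As :: "(real^3^3) list" where "\<And>x y. B x x y y = (\<Sum>A\<leftarrow>As. (x \<bullet> (A *v y))\<^sup>2)"
proof -
  obtain gs where gs: "\<forall>g\<in>set gs. bilinear g" "\<And>x y. B x x y y = (\<Sum>g\<leftarrow>gs. (g x y)\<^sup>2)"
    using assms unfolding sos_def by blast
  let ?m = "\<lambda>g :: real^3 \<Rightarrow> real^3 \<Rightarrow> real. (\<chi> i j. g (axis i 1) (axis j 1)) :: real^3^3"
  have "B x x y y = (\<Sum>g\<leftarrow>gs. (x \<bullet> (?m g *v y))\<^sup>2)" for x y
    unfolding gs(2) using gs(1) bilinear_matrix by (intro arg_cong[of _ _ sum_list] map_cong) auto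
  then show ?thesis using that[of "map ?m gs"] by (simp add: comp_def)
qed

text \<open>The determinant is a sum of squares of cubics, each bounded by it. By extremality a
  nonzero one among them is a positive multiple of the determinant, and rescaling the cubic gives
  the root.\<close>

lemma sos_extremal_perfect_square:
  fixes B :: "real^3 \<Rightarrow> real^3 \<Rightarrow> real^3 \<Rightarrow> real^3 \<Rightarrow> real"
  assumes "biform B" "sos B" and ext: "extremal_polynomial 3 (\<lambda>y. det (form_matrix B y))"
  shows "perfect_square (\<lambda>y. det (form_matrix B y))"
proof -
  obtain As where As: "\<And>x y. B x x y y = (\<Sum>A\<leftarrow>As. (x \<bullet> (A *v y))\<^sup>2)" using sos_matrices[OF assms(2)] by blast
  have "form_matrix B y = gram (map (\<lambda>A. A *v y) As)" for y
    by (rule sym_matrix_eqI[OF form_matrix_sym[OF assms(1)] gram_sym])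
      (simp add: form_matrix_form[OF assms(1)] As gram_form comp_def inner_commute)
  then obtain ps where ps: "\<forall>p\<in>set ps. homogeneous_polynomial 3 p"
    "\<And>y. det (form_matrix B y) = (\<Sum>p\<leftarrow>ps. (p y)\<^sup>2)" using det_gram_squares[of As] by auto
  obtain u where u: "det (form_matrix B u) \<noteq> 0" using ext unfolding extremal_polynomial_def by blast
  have "\<exists>p\<in>set ps. p u \<noteq> 0"
  proof (rule ccontr)
    assume "\<not> ?thesis"
    then have "(\<Sum>p\<leftarrow>ps. (p u)\<^sup>2) = (\<Sum>p\<leftarrow>ps. 0)"
      by (intro arg_cong[of _ _ sum_list] map_cong) auto
    then show False using u unfolding ps(2) by simp
  qed
  then obtain p where p: "p \<in> set ps" "p u \<noteq> 0" by blast
  have hp: "homogeneous_polynomial 3 p" using ps p by blast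
  have h6: "homogeneous_polynomial (2 * 3) (\<lambda>y. (p y)\<^sup>2)"
    using homogeneous_mult[OF hp hp] by (simp add: power2_eq_square)
  have "(p y)\<^sup>2 \<le> det (form_matrix B y)" for y
    unfolding ps(2) by (rule member_le_sum_list) (use p in auto)
  from extremal_summand[OF ext h6 _ this] obtain c where c: "\<And>y. (p y)\<^sup>2 = c * det (form_matrix B y)" by auto
  have "0 < c * det (form_matrix B u)" using c[of u] p(2) by (metis zero_less_power2)
  moreover have "det (form_matrix B u) \<ge> 0" using ext unfolding extremal_polynomial_def by blast
  ultimately have c0: "c > 0" by (simp add: zero_less_mult_iff)
  have "real_polynomial_function (\<lambda>y. (1 / sqrt c) * p y)"
    by (intro real_polynomial_function.intros(2,4) homogeneous_imp_real_polynomial[OF hp])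
  moreover have "det (form_matrix B y) = ((1 / sqrt c) * p y)\<^sup>2" for y
    using c0 c[of y] by (simp add: power_mult_distrib power_divide)
  ultimately show ?thesis unfolding perfect_square_def by blast
qed

lemma sum_list_square_tensor:
  fixes As :: "(real^3^3) list"
  shows "(\<Sum>i\<in>UNIV. \<Sum>j\<in>UNIV. \<Sum>k\<in>UNIV. \<Sum>l\<in>UNIV.
      (\<Sum>A\<leftarrow>As. (A$i$j * A$k$l + A$i$l * A$k$j) / 2) * \<xi>$i$j * \<xi>$k$l)
    = (\<Sum>A\<leftarrow>As. (A \<bullet> \<xi>)\<^sup>2 - cofactor_matrix A \<bullet> cofactor_matrix \<xi>)"
proof (induction As)
  case (Cons A As)
  have "(\<Sum>i\<in>UNIV. \<Sum>j\<in>UNIV. \<Sum>k\<in>UNIV. \<Sum>l\<in>UNIV. (A$i$j * A$k$l + A$i$l * A$k$j) / 2 * \<xi>$i$j * \<xi>$k$l)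
     = (A \<bullet> \<xi>)\<^sup>2 - cofactor_matrix A \<bullet> cofactor_matrix \<xi>"
    using cofactor_identity[of A \<xi>] by (simp add: sum_divide_distrib[symmetric])
  with Cons show ?case by (simp only: list.map sum_list.Cons distrib_right sum.distrib)
qed simp

text \<open>The tensor symmetries fix the minors to be added: the quadratic form is a sum of squares
  of linear functionals plus a linear function of the cofactors, which is convex in both arguments
  jointly.\<close>

lemma sos_polyconvex:
  assumes C: "tensor_symmetric C" and s: "sos (tensor_form C)"
  shows "polyconvex (quadratic_form C)"
proof -
  obtain As where As: "\<And>x y. tensor_form C x x y y = (\<Sum>A\<leftarrow>As. (x \<bullet> (A *v y))\<^sup>2)" using sos_matrices[OF s] by blast
  \<comment> \<open>The symmetric tensor of the sum of squares. It agrees with \<open>C\<close> on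
    rank-one matrices, where cofactors vanish, hence everywhere by polarisation.\<close>
  define E where "E = (\<lambda>i j k l. \<Sum>A\<leftarrow>As. (A$i$j * A$k$l + A$i$l * A$k$j) / 2)"
  have sE: "tensor_symmetric E" unfolding tensor_symmetric_def E_def
    by (simp add: add.commute mult.commute)
  have "tensor_form E x x y y = tensor_form C x x y y" for x y
  proof -
    have c: "cofactor_matrix (x \<otimes>\<^sub>o y) = 0"
      by (simp add: cofactor_matrix_def outer_product_def vec_eq_iff)
    have i: "A \<bullet> (x \<otimes>\<^sub>o y) = x \<bullet> (A *v y)" for A :: "real^3^3"
      by (simp add: outer_product_def inner_vec_def matrix_vector_mult_def sum_3 algebra_simps)
    have "tensor_form E x x y y = quadratic_form E (x \<otimes>\<^sub>o y)" by (simp add: quadratic_form_tensor_form)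
    also have "\<dots> = (\<Sum>A\<leftarrow>As. (A \<bullet> (x \<otimes>\<^sub>o y))\<^sup>2 - cofactor_matrix A \<bullet> cofactor_matrix (x \<otimes>\<^sub>o y))"
      unfolding quadratic_form_def E_def by (rule sum_list_square_tensor)
    also have "\<dots> = (\<Sum>A\<leftarrow>As. (x \<bullet> (A *v y))\<^sup>2)" by (simp add: c i)
    finally show ?thesis by (simp add: As)
  qed
  from biform_eqI[OF biform_tensor_form[OF sE] biform_tensor_form[OF C] this]
  have "E i j k l = C i j k l" for i j k l
    using tensor_form_coeff[of E i k j l] tensor_form_coeff[of C i k j l] by simp
  then have CE: "quadratic_form C = quadratic_form E" unfolding quadratic_form_def by simp
  have q: "quadratic_form C \<xi> = (\<Sum>A\<leftarrow>As. (A \<bullet> \<xi>)\<^sup>2 - cofactor_matrix A \<bullet> cofactor_matrix \<xi>)" for \<xi>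
    unfolding CE unfolding quadratic_form_def E_def by (rule sum_list_square_tensor)
  define g where "g As p = (\<Sum>A\<leftarrow>As. (A \<bullet> fst p)\<^sup>2 - cofactor_matrix A \<bullet> fst (snd p))"
    for As :: "(real^3^3) list" and p :: "(real^3^3) \<times> (real^3^3) \<times> real"
  have "convex_on UNIV (g As)" for As
  proof (rule convex_onI)
    fix t :: real and p q :: "(real^3^3) \<times> (real^3^3) \<times> real" assume t: "0 < t" "t < 1"
    show "g As ((1 - t) *\<^sub>R p + t *\<^sub>R q) \<le> (1 - t) * g As p + t * g As q"
    proof (induction As)
      case (Cons A As)
      have "((1 - t) * a + t * b)\<^sup>2 \<le> (1 - t) * a\<^sup>2 + t * b\<^sup>2" for a b :: real
      proof -
        have "(1 - t) * a\<^sup>2 + t * b\<^sup>2 - ((1 - t) * a + t * b)\<^sup>2 = t * (1 - t) * (a - b)\<^sup>2" by algebra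
        also have "\<dots> \<ge> 0" using t by simp
        finally show ?thesis by simp
      qed
      from this[of "A \<bullet> fst p" "A \<bullet> fst q"] Cons show ?case
        unfolding g_def by (simp add: inner_add_right algebra_simps)
    qed (simp add: g_def)
  qed simp
  moreover have "quadratic_form C \<xi> = g As (\<xi>, cofactor_matrix \<xi>, det \<xi>)" for \<xi> unfolding q g_def by simp
  ultimately show ?thesis unfolding polyconvex_def by blast
qed

section \<open>Decomposition of forms with extremal determinant\<close>

text \<open>The four coefficients of the pencil determinant are nonnegative sextics with sum
  \<open>det (A + B)\<close>; extremality makes each a constant multiple of that sum.\<close>

lemma proportional_pencil_dets:
  fixes A B :: "real^3 \<Rightarrow> real^3 \<Rightarrow> real^3 \<Rightarrow> real^3 \<Rightarrow> real"
  assumes A: "biform A" "psd A" and B: "biform B" "psd B"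
    and hom: "\<And>i k. homogeneous_polynomial 2 (\<lambda>y. form_matrix A y $ i $ k)"
      "\<And>i k. homogeneous_polynomial 2 (\<lambda>y. form_matrix B y $ i $ k)"
    and ext: "extremal_polynomial 3 (\<lambda>y. det (form_matrix A y + form_matrix B y))"
  obtains c0 c1 c2 c3 :: real where "\<And>s t y. det (s *\<^sub>R form_matrix A y + t *\<^sub>R form_matrix B y) =
    (c0 * s ^ 3 + c1 * (s\<^sup>2 * t) + c2 * (s * t\<^sup>2) + c3 * t ^ 3) * det (form_matrix A y + form_matrix B y)"
proof -
  let ?A = "form_matrix A" and ?B = "form_matrix B"
  have sum: "det (?A y + ?B y) = det (?A y) + mixed_det (?A y) (?B y) + mixed_det (?B y) (?A y) + det (?B y)" for y
    using det_pencil[of 1 "?A y" 1 "?B y"] by simp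
  note nn = psd_det_bounds[OF A B] psd_det_bounds[OF B A]
  have h: "homogeneous_polynomial (2 * 3) (\<lambda>y. det (?A y))" "homogeneous_polynomial (2 * 3) (\<lambda>y. mixed_det (?A y) (?B y))"
    "homogeneous_polynomial (2 * 3) (\<lambda>y. mixed_det (?B y) (?A y))" "homogeneous_polynomial (2 * 3) (\<lambda>y. det (?B y))"
    using homogeneous_det[of 2, OF hom(1)] homogeneous_det[of 2, OF hom(2)]
      homogeneous_mixed_det[of 2, OF hom(1,2)] homogeneous_mixed_det[of 2, OF hom(2,1)] by simp_all
  have le: "det (?A y) \<le> det (?A y + ?B y)" "mixed_det (?A y) (?B y) \<le> det (?A y + ?B y)"
    "mixed_det (?B y) (?A y) \<le> det (?A y + ?B y)" "det (?B y) \<le> det (?A y + ?B y)" for y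
    using nn[of y] unfolding sum by linarith+
  obtain c0 where c0: "\<And>y. det (?A y) = c0 * det (?A y + ?B y)" using extremal_summand[OF ext h(1) nn(1) le(1)] by blast
  obtain c1 where c1: "\<And>y. mixed_det (?A y) (?B y) = c1 * det (?A y + ?B y)" using extremal_summand[OF ext h(2) nn(2) le(2)] by blast
  obtain c2 where c2: "\<And>y. mixed_det (?B y) (?A y) = c2 * det (?A y + ?B y)" using extremal_summand[OF ext h(3) nn(4) le(3)] by blast
  obtain c3 where c3: "\<And>y. det (?B y) = c3 * det (?A y + ?B y)" using extremal_summand[OF ext h(4) nn(3) le(4)] by blast
  have "det (s *\<^sub>R ?A y + t *\<^sub>R ?B y) =
    (c0 * s ^ 3 + c1 * (s\<^sup>2 * t) + c2 * (s * t\<^sup>2) + c3 * t ^ 3) * det (?A y + ?B y)" for s t y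
    unfolding det_pencil c1[of y] c2[of y] by (subst c0, subst c3) (simp add: algebra_simps)
  then show ?thesis using that by blast
qed

lemma sos_if_singular_det:
  fixes B :: "real^3 \<Rightarrow> real^3 \<Rightarrow> real^3 \<Rightarrow> real^3 \<Rightarrow> real"
  assumes "biform B" "psd B" "\<And>y. det (form_matrix B y) = 0"
  shows "sos B"
  using sos_if_singular[OF assms(1,2)] det_form_matrix_zero_iff[OF assms(1,2)] assms(3) by blast

text \<open>Subtracting \<open>c T\<close> from \<open>s A + t B\<close> shifts both coefficients by
  \<open>c\<close>, so the pencil of such a form against \<open>T\<close> has the factor
  \<open>p (s - c) (t - c)\<close>, independent of \<open>y\<close>. A nonnegative form in this
  family with no positive multiple of \<open>T\<close> below it must therefore be singular for all
  \<open>y\<close>.\<close>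

lemma sos_if_decomposable:
  fixes A B :: "real^3 \<Rightarrow> real^3 \<Rightarrow> real^3 \<Rightarrow> real^3 \<Rightarrow> real"
  assumes A: "biform A" "psd A" and B: "biform B" "psd B"
    and hom: "\<And>i k. homogeneous_polynomial 2 (\<lambda>y. form_matrix A y $ i $ k)"
      "\<And>i k. homogeneous_polynomial 2 (\<lambda>y. form_matrix B y $ i $ k)"
    and T: "\<And>x x' y y'. T x x' y y' = A x x' y y' + B x x' y y'"
    and ext: "extremal_polynomial 3 (\<lambda>y. det (form_matrix T y))"
    and indep: "\<And>c. \<exists>x y. A x x y y \<noteq> c * T x x y y"
  shows "sos T"
proof -
  have bT: "biform T"
    using biform_add_scale[OF A(1) B(1), of 1 1] T by (simp add: T[abs_def])
  have pT: "psd T" using A(2) B(2) unfolding psd_def T by (simp add: add_nonneg_nonneg)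
  have mT: "form_matrix T y = form_matrix A y + form_matrix B y" for y
    by (simp add: form_matrix_def vec_eq_iff T)
  obtain c0 c1 c2 c3 where pencil: "\<And>s t y. det (s *\<^sub>R form_matrix A y + t *\<^sub>R form_matrix B y) =
    (c0 * s ^ 3 + c1 * (s\<^sup>2 * t) + c2 * (s * t\<^sup>2) + c3 * t ^ 3) * det (form_matrix A y + form_matrix B y)"
    by (rule proportional_pencil_dets[OF A B hom ext[unfolded mT]], rule that)
  define p where "p s t = c0 * s ^ 3 + c1 * (s\<^sup>2 * t) + c2 * (s * t\<^sup>2) + c3 * t ^ 3" for s t
  note pencil = pencil[folded p_def mT]
  obtain u where u: "det (form_matrix T u) \<noteq> 0" using ext unfolding extremal_polynomial_def by blast
  have pol: "real_polynomial_function (\<lambda>y. det (form_matrix T y))"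
    using ext homogeneous_imp_real_polynomial unfolding extremal_polynomial_def by blast
  have singular: "det (form_matrix S y) = 0"
    if S: "biform S" "psd S" "\<And>x x' y y'. S x x' y y' = s * A x x' y y' + t * B x x' y y'"
      and max: "\<And>e. e > 0 \<Longrightarrow> \<exists>x y. S x x y y < e * T x x y y" for S s t y
  proof -
    have m: "form_matrix S y - c *\<^sub>R form_matrix T y = (s - c) *\<^sub>R form_matrix A y + (t - c) *\<^sub>R form_matrix B y" for c y
      by (simp add: form_matrix_def vec_eq_iff T S(3) algebra_simps)
    have d: "det (form_matrix S y - c *\<^sub>R form_matrix T y) = p (s - c) (t - c) * det (form_matrix T y)" for c y
      unfolding m by (rule pencil)
    have "p (s - 0) (t - 0) = 0"
    proof (rule ccontr)
      assume n: "p (s - 0) (t - 0) \<noteq> 0"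
      have "continuous_on UNIV (\<lambda>c. p (s - c) (t - c))" unfolding p_def by (intro continuous_intros)
      from positive_multiple_below[OF S(1,2) bT pT this n d pol u] obtain e where
        "e > 0" "\<And>x y. e * T x x y y \<le> S x x y y" by blast
      then show False using max[of e] by (meson not_le)
    qed
    then show ?thesis using d[of y 0] by simp
  qed
  obtain w1 where w1: "(\<lambda>(x, y). T x x y y) w1 \<noteq> 0"
  proof -
    obtain x y where "A x x y y \<noteq> 0" using indep[of 0] by auto
    moreover have "0 \<le> A x x y y" "0 \<le> B x x y y" using A(2) B(2) unfolding psd_def by blast+
    ultimately have "T x x y y \<noteq> 0" unfolding T by simp
    then show ?thesis using that[of "(x, y)"] by simp
  qed
  have TA: "0 \<le> (\<lambda>(x, y). T x x y y) z" "0 \<le> (\<lambda>(x, y). A x x y y) z" for z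
    using pT A(2) unfolding psd_def by (simp_all split: prod.split)
  obtain c where c: "0 \<le> c" "\<And>z. c * (\<lambda>(x, y). T x x y y) z \<le> (\<lambda>(x, y). A x x y y) z"
    "\<And>e. e > 0 \<Longrightarrow> \<exists>z. (\<lambda>(x, y). A x x y y) z < (c + e) * (\<lambda>(x, y). T x x y y) z"
    by (rule greatest_multiple_below[where f = "\<lambda>(x, y). T x x y y" and g = "\<lambda>(x, y). A x x y y", OF TA w1], rule that)
  define S where "S = (\<lambda>x x' y y'. (1 - c) * A x x' y y' + (- c) * B x x' y y')"
  have Sd: "S x x' y y' = A x x' y y' - c * T x x' y y'" for x x' y y' by (simp add: S_def T algebra_simps)
  have bS: "biform S" unfolding S_def by (rule biform_add_scale[OF A(1) B(1)])
  have pS: "psd S" using c(2) unfolding psd_def Sd by auto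
  have "det (form_matrix S y) = 0" for y
  proof (rule singular[OF bS pS])
    show "S x x' y y' = (1 - c) * A x x' y y' + (- c) * B x x' y y'" for x x' y y' unfolding S_def ..
    show "\<exists>x y. S x x y y < e * T x x y y" if "e > 0" for e
      using c(3)[OF that] unfolding Sd by (auto simp: algebra_simps)
  qed
  then have sS: "sos S" by (rule sos_if_singular_det[OF bS pS])
  have ST: "S x x y y \<le> T x x y y" for x y
  proof -
    have "0 \<le> B x x y y" "0 \<le> c * T x x y y" using B(2) pT c(1) unfolding psd_def by simp_all
    then show ?thesis using T[of x x y y] unfolding Sd by linarith
  qed
  \<comment> \<open>\<open>S\<close> is not identically zero, as otherwise \<open>A\<close> would be
    \<open>c\<close> times \<open>T\<close>.\<close>
  obtain w2 where w2: "(\<lambda>(x, y). S x x y y) w2 \<noteq> 0" using indep[of c] unfolding Sd by auto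
  have SS: "0 \<le> (\<lambda>(x, y). S x x y y) z" for z using pS unfolding psd_def by (simp split: prod.split)
  obtain d where d: "0 \<le> d" "\<And>z. d * (\<lambda>(x, y). S x x y y) z \<le> (\<lambda>(x, y). T x x y y) z"
    "\<And>e. e > 0 \<Longrightarrow> \<exists>z. (\<lambda>(x, y). T x x y y) z < (d + e) * (\<lambda>(x, y). S x x y y) z"
    by (rule greatest_multiple_below[where f = "\<lambda>(x, y). S x x y y" and g = "\<lambda>(x, y). T x x y y", OF SS TA(1) w2], rule that)
  define R where "R = (\<lambda>x x' y y'. (1 - d * (1 - c)) * A x x' y y' + (1 + d * c) * B x x' y y')"
  have Rd: "R x x' y y' = T x x' y y' - d * S x x' y y'" for x x' y y' by (simp add: R_def S_def T algebra_simps)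
  have bR: "biform R" unfolding R_def by (rule biform_add_scale[OF A(1) B(1)])
  have pR: "psd R" using d(2) unfolding psd_def Rd by auto
  have "det (form_matrix R y) = 0" for y
  proof (rule singular[OF bR pR])
    show "R x x' y y' = (1 - d * (1 - c)) * A x x' y y' + (1 + d * c) * B x x' y y'" for x x' y y' unfolding R_def ..
    show "\<exists>x y. R x x y y < e * T x x y y" if "e > 0" for e
    proof -
      obtain x y where xy: "T x x y y < (d + e) * S x x y y" using d(3)[OF \<open>e > 0\<close>] by auto
      \<comment> \<open>Maximality of \<open>d\<close> concerns multiples of \<open>S\<close>,
        whereas \<open>singular\<close> asks about multiples of \<open>T\<close>; the bound of
        \<open>S\<close> by \<open>T\<close> bridges the two.\<close>
      have "e * S x x y y \<le> e * T x x y y" using ST that by simp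
      then have "R x x y y < e * T x x y y" using xy unfolding Rd by (simp add: algebra_simps)
      then show ?thesis by blast
    qed
  qed
  then have sR: "sos R" by (rule sos_if_singular_det[OF bR pR])
  show ?thesis by (rule sos_combine[OF sR sS d(1)]) (simp add: Rd)
qed

text \<open>A witness against extremality is a summand \<open>g\<close> of the cone; its tensor
  \<open>C1\<close> and the difference \<open>C2\<close> supply the two nonnegative forms of the
  decomposition.\<close>

lemma sos_if_not_extreme_ray:
  assumes C: "tensor_symmetric C" and f: "quadratic_form C \<in> quasiconvex_cone"
    and ext: "extremal_polynomial 3 (\<lambda>y. det (acoustic_tensor C y))"
    and ne: "\<not> extreme_ray (quadratic_form C)"
  shows "sos (tensor_form C)"
proof -
  obtain g where g: "g \<in> quasiconvex_cone" "(\<lambda>\<xi>. quadratic_form C \<xi> - g \<xi>) \<in> quasiconvex_cone"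
    and ng: "\<And>c::real. g \<noteq> (\<lambda>\<xi>. c * quadratic_form C \<xi>)"
    using ne f unfolding extreme_ray_def by blast
  obtain C1 where C1: "tensor_symmetric C1" "g = quadratic_form C1"
    using g(1) unfolding quasiconvex_cone_def by blast
  define C2 where "C2 = (\<lambda>i j k l. C i j k l - C1 i j k l)"
  have C2: "tensor_symmetric C2" using C C1(1) unfolding tensor_symmetric_def C2_def by metis
  have T: "tensor_form C x x' y y' = tensor_form C1 x x' y y' + tensor_form C2 x x' y y'" for x x' y y'
    unfolding tensor_form_def C2_def by (simp add: sum.distrib[symmetric] algebra_simps)
  have p1: "psd (tensor_form C1)"
    using g(1) unfolding quasiconvex_cone_def C1(2) quasiconvex_quadratic_def psd_def
    by (simp add: quadratic_form_tensor_form)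
  have p2: "psd (tensor_form C2)"
    using g(2) unfolding quasiconvex_cone_def C1(2) quasiconvex_quadratic_def psd_def
    by (simp add: quadratic_form_tensor_form T)
  note b = biform_tensor_form[OF C] biform_tensor_form[OF C1(1)] biform_tensor_form[OF C2]
  \<comment> \<open>Proportionality on rank-one matrices would polarise to proportionality of the
    tensors, and so of \<open>g\<close> and the form on all matrices.\<close>
  have indep: "\<exists>x y. tensor_form C1 x x y y \<noteq> c * tensor_form C x x y y" for c
  proof (rule ccontr)
    assume "\<not> ?thesis"
    then have eq: "tensor_form C1 x x y y = (\<lambda>x x' y y'. c * tensor_form C x x' y y' + 0 * tensor_form C x x' y y') x x y y" for x y
      by simp
    have "tensor_form C1 x x' y y' = c * tensor_form C x x' y y'" for x x' y y'
      using biform_eqI[OF b(2) biform_add_scale[OF b(1) b(1)] eq] by simp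
    then have "C1 i j k l = c * C i j k l" for i j k l
      using tensor_form_coeff[of C1 i k j l] tensor_form_coeff[of C i k j l] by metis
    then have "g = (\<lambda>\<xi>. c * quadratic_form C \<xi>)"
      unfolding C1(2) quadratic_form_def by (simp add: sum_distrib_left mult.assoc)
    then show False using ng by blast
  qed
  show ?thesis
    by (rule sos_if_decomposable[OF b(2) p1 b(3) p2 homogeneous_acoustic_tensor homogeneous_acoustic_tensor T
          ext[unfolded acoustic_tensor_form_matrix] indep])
qed

theorem theorem2p1:
  fixes C :: "3 \<Rightarrow> 3 \<Rightarrow> 3 \<Rightarrow> 3 \<Rightarrow> real"
  assumes "tensor_symmetric C"
    and "quadratic_form C \<in> quasiconvex_cone"
    and "extremal_polynomial 3 (\<lambda>y. det (acoustic_tensor C y))"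
  shows "(\<not> perfect_square (\<lambda>y. det (acoustic_tensor C y)) \<longrightarrow> extreme_ray (quadratic_form C)) \<and>
         (perfect_square (\<lambda>y. det (acoustic_tensor C y)) \<longrightarrow>
            extreme_ray (quadratic_form C) \<or> polyconvex (quadratic_form C))"
proof (cases "extreme_ray (quadratic_form C)")
  case False
  have s: "sos (tensor_form C)" by (rule sos_if_not_extreme_ray[OF assms False])
  \<comment> \<open>Failure of extremality forces a perfect square, which is the contrapositive of
    the first claim; polyconvexity then settles the second.\<close>
  have "perfect_square (\<lambda>y. det (acoustic_tensor C y))"
    using sos_extremal_perfect_square[OF biform_tensor_form[OF assms(1)] s] assms(3)
    unfolding acoustic_tensor_form_matrix by blast
  moreover have "polyconvex (quadratic_form C)" by (rule sos_polyconvex[OF assms(1) s])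
  ultimately show ?thesis by blast
qed simp

end
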